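(* Let $D \subseteq \omega$ be noncomputable. Then there exists a $2$--r--cohesive set $A$ such that $D \not\le_T A$.
   Context: A $2$--coloring of $[\omega]^2$ (the $2$--element subsets of $\omega$) is a function $\mathcal{C}:[\omega]^2\to\{0,1\}$. $A$ is almost homogeneous for $\mathcal{C}$ if there is a finite $F$ such that $\mathcal{C}$ is constant on $[A\setminus F]^2$. An infinite set $A$ is $2$--r--cohesive if it is almost homogeneous for every computable $2$--coloring of $[\omega]^2$. *)

theory Defs
  imports Main "HOL-Library.Ramsey"
begin

text \<open>
  Codes for the partial functions (of any arity) that are partial recursive relative to a
  set \<open>X\<close>: the least class containing the basic functions and the characteristic function of
  \<open>X\<close> (the code \<open>Query\<close>), and closed under composition, primitive recursion and unbounded
  minimisation.
\<close>

datatype code =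
    Zero
  | Succ
  | Proj nat
  | Query
  | Comp code "code list"
  | PrimRec code code
  | Mu code

text \<open>
  \<open>computes X p xs y\<close>: the function coded by \<open>p\<close> relative to \<open>X\<close> is defined on the argument
  list \<open>xs\<close> and has value \<open>y\<close>. It is undefined on \<open>xs\<close> if there is no such \<open>y\<close>; in particular on
  argument lists of unsuitable length.
\<close>

inductive computes :: "nat set \<Rightarrow> code \<Rightarrow> nat list \<Rightarrow> nat \<Rightarrow> bool" for X where
  zero: "computes X Zero xs 0"
| succ: "computes X Succ [x] (Suc x)"
| proj: "i < length xs \<Longrightarrow> computes X (Proj i) xs (xs ! i)"
| query: "computes X Query [x] (of_bool (x \<in> X))"
| comp: "list_all2 (\<lambda>q y. computes X q xs y) qs ys \<Longrightarrow> computes X p ys z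
    \<Longrightarrow> computes X (Comp p qs) xs z"
| primrec_0: "computes X p xs y \<Longrightarrow> computes X (PrimRec p q) (0 # xs) y"
| primrec_Suc: "computes X (PrimRec p q) (n # xs) y \<Longrightarrow> computes X q (n # y # xs) z
    \<Longrightarrow> computes X (PrimRec p q) (Suc n # xs) z"
| mu: "computes X p (n # xs) 0 \<Longrightarrow> (\<And>m. m < n \<Longrightarrow> \<exists>k. computes X p (m # xs) (Suc k))
    \<Longrightarrow> computes X (Mu p) xs n"

lemma computes_deterministic:
  "computes X p xs y \<Longrightarrow> computes X p xs z \<Longrightarrow> y = z"
proof (induction arbitrary: z rule: computes.induct)
  case (zero xs)
  then show ?case by cases simp
next
  case (succ x)
  then show ?case by cases simp
next
  case (proj i xs)
  from proj.prems show ?case by cases simp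
next
  case (query x)
  then show ?case by cases simp
next
  case (comp xs qs ys p y)
  from comp.prems obtain ys'
    where ys': "list_all2 (\<lambda>q y. computes X q xs y) qs ys'" "computes X p ys' z"
  proof cases
    case (comp ys')
    from that[OF comp] show ?thesis .
  qed
  have len: "length ys = length ys'"
    using list_all2_lengthD[OF comp.IH(1)] list_all2_lengthD[OF ys'(1)] by simp
  have "ys ! i = ys' ! i" if "i < length ys" for i
    using list_all2_nthD2[OF comp.IH(1) that] list_all2_nthD2[OF ys'(1), of i] that len by simp
  then have "ys = ys'"
    using len by (simp add: nth_equalityI)
  then show ?case
    using comp.IH(2) ys'(2) by simp
next
  case (primrec_0 p xs y q)
  from primrec_0.prems have "computes X p xs z" by cases
  then show ?case by (rule primrec_0.IH)
next
  case (primrec_Suc p q n xs y w)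
  from primrec_Suc.prems obtain y'
    where y': "computes X (PrimRec p q) (n # xs) y'" "computes X q (n # y' # xs) z"
  proof cases
    case (primrec_Suc y')
    from that[OF primrec_Suc] show ?thesis .
  qed
  from primrec_Suc.IH(1)[OF y'(1)] y'(2) have "computes X q (n # y # xs) z" by simp
  then show ?case by (rule primrec_Suc.IH(2))
next
  case (mu p n xs)
  from mu.prems have z: "computes X p (z # xs) 0"
    and less_z: "\<And>m. m < z \<Longrightarrow> \<exists>k. computes X p (m # xs) (Suc k)"
    by (cases, simp)+
  have "\<not> n < z"
  proof
    assume "n < z"
    then obtain k where "computes X p (n # xs) (Suc k)" using less_z by blast
    from mu.IH(1)[OF this] show False by simp
  qed
  moreover have "\<not> z < n"
  proof
    assume "z < n"
    from mu.IH(2)[OF this] z show False by fastforce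
  qed
  ultimately show ?case by simp
qed

definition turing_reducible :: "nat set \<Rightarrow> nat set \<Rightarrow> bool"  (infix \<open>\<le>\<^sub>T\<close> 50) where
  "D \<le>\<^sub>T A \<longleftrightarrow> (\<exists>p. \<forall>n. computes A p [n] (of_bool (n \<in> D)))"

text \<open>
  Plain computability is computability relative to the empty set, whose characteristic
  function is constantly zero.
\<close>

definition computable_set :: "nat set \<Rightarrow> bool" where
  "computable_set D \<longleftrightarrow> D \<le>\<^sub>T {}"

text \<open>
  Only the values of \<open>C\<close> on two-element sets matter. As inputs of computations, these sets are
  represented by their elements in increasing order.
\<close>

definition two_coloring :: "(nat set \<Rightarrow> nat) \<Rightarrow> bool" where
  "two_coloring C \<longleftrightarrow> C \<in> [UNIV]\<^bsup>2\<^esup> \<rightarrow> {0, 1}"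

definition computable_coloring :: "(nat set \<Rightarrow> nat) \<Rightarrow> bool" where
  "computable_coloring C \<longleftrightarrow> (\<exists>p. \<forall>x y. x < y \<longrightarrow> computes {} p [x, y] (C {x, y}))"

definition almost_homogeneous :: "(nat set \<Rightarrow> nat) \<Rightarrow> nat set \<Rightarrow> bool" where
  "almost_homogeneous C A \<longleftrightarrow> (\<exists>F. finite F \<and> (\<exists>c. \<forall>e \<in> [A - F]\<^bsup>2\<^esup>. C e = c))"

definition two_r_cohesive :: "nat set \<Rightarrow> bool" where
  "two_r_cohesive A \<longleftrightarrow> infinite A \<and>
     (\<forall>C. two_coloring C \<and> computable_coloring C \<longrightarrow> almost_homogeneous C A)"

end

theory Submission
  imports Defs "HOL-Library.Nat_Bijection" "HOL-Library.Countable"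
begin

text \<open>
  Call a property of infinite sets dense if every infinite set that does not compute \<open>D\<close> has an
  infinite subset that has the property and does not compute \<open>D\<close> either. Mathias forcing with
  conditions \<open>(F, X)\<close>, where \<open>X\<close> does not compute \<open>D\<close>, yields for countably many dense hereditary
  properties an infinite set that does not compute \<open>D\<close> and has each property up to finitely many
  elements. So it suffices that homogeneity for a computable coloring is dense, which is Seetapun's
  theorem. Mathias forcing also reduces Seetapun's theorem to colorings for which every \<open>x\<close> has a
  limit color; then one passes to an infinite set on which the limit color is constant, and thins
  it out greedily. That the former is possible is strong cone avoidance for the pigeonhole
  principle (Dzhafarov and Jockusch): if no finite extension within the partition by \<open>A\<close> forces a
  wrong value, then, since \<open>X\<close> does not compute \<open>D\<close>, the closed set of all partitions \<open>Z\<close> that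
  avoid a certain value \<open>D n\<close> is nonempty, and it has a member that does not compute \<open>D\<close>.
\<close>

section \<open>Total functions recursive in an oracle\<close>

definition recursive_in :: "nat set \<Rightarrow> (nat \<Rightarrow> nat) \<Rightarrow> bool" where
  "recursive_in X f \<longleftrightarrow> (\<exists>c. \<forall>n. computes X c [n] (f n))"

definition recursive2_in :: "nat set \<Rightarrow> (nat \<Rightarrow> nat \<Rightarrow> nat) \<Rightarrow> bool" where
  "recursive2_in X f \<longleftrightarrow> (\<exists>c. \<forall>m n. computes X c [m, n] (f m n))"

abbreviation decidable_in :: "nat set \<Rightarrow> (nat \<Rightarrow> bool) \<Rightarrow> bool" where
  "decidable_in X P \<equiv> recursive_in X (\<lambda>n. of_bool (P n))"

text \<open>
  Predicates of several variables are treated as predicates of one environment \<open>e\<close>, a nested pair: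
  under a quantifier the bound variable is \<open>pfst e\<close> and the outer environment \<open>psnd e\<close>.
\<close>

abbreviation pair :: "nat \<Rightarrow> nat \<Rightarrow> nat" where
  "pair m n \<equiv> prod_encode (m, n)"

abbreviation pfst :: "nat \<Rightarrow> nat" where
  "pfst e \<equiv> fst (prod_decode e)"

abbreviation psnd :: "nat \<Rightarrow> nat" where
  "psnd e \<equiv> snd (prod_decode e)"

section \<open>Closure properties and elementary arithmetic\<close>

lemma computes_Comp1:
  "computes X q xs y \<Longrightarrow> computes X p [y] z \<Longrightarrow> computes X (Comp p [q]) xs z"
  by (rule computes.comp[where ys = "[y]"]) auto

lemma computes_Comp2:
  "computes X q xs y \<Longrightarrow> computes X r xs y' \<Longrightarrow> computes X p [y, y'] z
    \<Longrightarrow> computes X (Comp p [q, r]) xs z"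
  by (rule computes.comp[where ys = "[y, y']"]) auto

lemma computes_Proj: "i < length xs \<Longrightarrow> y = xs ! i \<Longrightarrow> computes X (Proj i) xs y"
  by (simp add: computes.proj)

lemma turing_reducible_iff: "D \<le>\<^sub>T X \<longleftrightarrow> decidable_in X (\<lambda>n. n \<in> D)"
  by (simp add: turing_reducible_def recursive_in_def)

lemma recursive_in_cong: "recursive_in X f \<Longrightarrow> (\<And>n. f n = g n) \<Longrightarrow> recursive_in X g"
  by (simp add: recursive_in_def)

lemma recursive_in_id: "recursive_in X (\<lambda>n. n)"
  unfolding recursive_in_def by (rule exI[of _ "Proj 0"]) (simp add: computes_Proj)

lemma recursive_in_comp:
  assumes "recursive_in X f" "recursive_in X g"
  shows "recursive_in X (\<lambda>n. f (g n))"
proof -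
  obtain p q where "\<And>n. computes X p [n] (f n)" "\<And>n. computes X q [n] (g n)"
    using assms unfolding recursive_in_def by blast
  then have "computes X (Comp p [q]) [n] (f (g n))" for n
    by (blast intro: computes_Comp1)
  then show ?thesis
    unfolding recursive_in_def by blast
qed

lemma recursive2_in_comp:
  assumes "recursive2_in X f" "recursive_in X a" "recursive_in X b"
  shows "recursive_in X (\<lambda>n. f (a n) (b n))"
proof -
  obtain p q r where "\<And>m n. computes X p [m, n] (f m n)" "\<And>n. computes X q [n] (a n)"
    "\<And>n. computes X r [n] (b n)"
    using assms unfolding recursive_in_def recursive2_in_def by blast
  then have "computes X (Comp p [q, r]) [n] (f (a n) (b n))" for n
    by (blast intro: computes_Comp2)
  then show ?thesis
    unfolding recursive_in_def by blast
qed

lemma recursive2_in_fst: "recursive2_in X (\<lambda>m n. m)"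
  unfolding recursive2_in_def by (rule exI[of _ "Proj 0"]) (simp add: computes_Proj)

lemma recursive2_in_snd: "recursive2_in X (\<lambda>m n. n)"
  unfolding recursive2_in_def by (rule exI[of _ "Proj 1"]) (simp add: computes_Proj)

lemma recursive2_in_comp1:
  assumes "recursive_in X f" "recursive2_in X g"
  shows "recursive2_in X (\<lambda>m n. f (g m n))"
proof -
  obtain p q where "\<And>n. computes X p [n] (f n)" "\<And>m n. computes X q [m, n] (g m n)"
    using assms unfolding recursive_in_def recursive2_in_def by blast
  then have "computes X (Comp p [q]) [m, n] (f (g m n))" for m n
    by (blast intro: computes_Comp1)
  then show ?thesis
    unfolding recursive2_in_def by blast
qed

lemma recursive2_in_comp2:
  assumes "recursive2_in X f" "recursive2_in X a" "recursive2_in X b"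
  shows "recursive2_in X (\<lambda>m n. f (a m n) (b m n))"
proof -
  obtain p q r where "\<And>m n. computes X p [m, n] (f m n)" "\<And>m n. computes X q [m, n] (a m n)"
    "\<And>m n. computes X r [m, n] (b m n)"
    using assms unfolding recursive2_in_def by blast
  then have "computes X (Comp p [q, r]) [m, n] (f (a m n) (b m n))" for m n
    by (blast intro: computes_Comp2)
  then show ?thesis
    unfolding recursive2_in_def by blast
qed

lemma computes_const: "\<exists>c. \<forall>xs. computes X c xs k"
proof (induction k)
  case 0
  then show ?case
    using computes.zero by blast
next
  case (Suc k)
  then obtain c where "\<And>xs. computes X c xs k" by blast
  then have "computes X (Comp Succ [c]) xs (Suc k)" for xs
    by (blast intro: computes_Comp1 computes.succ)
  then show ?case by blast
qed

lemma recursive_in_const: "recursive_in X (\<lambda>n. k)"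
  unfolding recursive_in_def using computes_const by blast

lemma recursive_in_Suc:
  assumes "recursive_in X f" shows "recursive_in X (\<lambda>n. Suc (f n))"
proof -
  have "recursive_in X Suc"
    unfolding recursive_in_def using computes.succ by blast
  from recursive_in_comp[OF this assms] show ?thesis .
qed

lemma recursive_in_rec_nat:
  assumes "recursive2_in X g"
  shows "recursive_in X (rec_nat a g)"
proof -
  obtain p q where p: "\<And>xs. computes X p xs a" and q: "\<And>m n. computes X q [m, n] (g m n)"
    using assms computes_const unfolding recursive2_in_def by blast
  have "computes X (PrimRec p q) [n] (rec_nat a g n)" for n
    by (induction n) (auto intro: p q computes.intros)
  then show ?thesis
    unfolding recursive_in_def by blast
qed

lemma recursive2_in_add: "recursive2_in X (+)"
proof -
  let ?c = "PrimRec (Proj 0) (Comp Succ [Proj 1])"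
  have "computes X ?c [m, n] (m + n)" for m n
    by (induction m)
      (auto intro!: computes.primrec_0 computes.primrec_Suc computes_Comp1 computes_Proj
        computes.succ)
  then show ?thesis
    unfolding recursive2_in_def by blast
qed

lemma recursive_in_pred:
  assumes "recursive_in X f" shows "recursive_in X (\<lambda>n. f n - 1)"
proof -
  have "rec_nat 0 (\<lambda>m _. m) n = n - 1" for n
    by (cases n) auto
  then have "recursive_in X (\<lambda>n. n - 1)"
    by (rule recursive_in_cong[OF recursive_in_rec_nat[OF recursive2_in_fst]])
  from recursive_in_comp[OF this assms] show ?thesis .
qed

lemma recursive2_in_diff: "recursive2_in X (-)"
proof -
  obtain p where p: "\<And>n. computes X p [n] (n - 1)"
    using recursive_in_pred[OF recursive_in_id] unfolding recursive_in_def by blast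
  \<comment> \<open>\<open>PrimRec\<close> recurses on the first argument, so \<open>?c\<close>
    takes the subtrahend first and the final code swaps the arguments.\<close>
  let ?c = "PrimRec (Proj 0) (Comp p [Proj 1])"
  have *: "computes X ?c [m, n] (n - m)" for m n
  proof (induction m)
    case (Suc m)
    then show ?case
      using p[of "n - m"]
      by (auto intro!: computes.primrec_Suc computes_Comp1 computes_Proj)
  qed (auto intro!: computes.primrec_0 computes_Proj)
  have "computes X (Comp ?c [Proj 1, Proj 0]) [m, n] (m - n)" for m n
    by (rule computes_Comp2[OF _ _ *]) (auto intro!: computes_Proj)
  then show ?thesis
    unfolding recursive2_in_def by blast
qed

lemmas recursive_in_add = recursive2_in_comp[OF recursive2_in_add]
lemmas recursive_in_diff = recursive2_in_comp[OF recursive2_in_diff]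

lemma recursive_in_Least:
  assumes "recursive2_in X f" "\<And>n. \<exists>x. f x n = 0"
  shows "recursive_in X (\<lambda>n. LEAST x. f x n = 0)"
proof -
  obtain p where p: "\<And>m n. computes X p [m, n] (f m n)"
    using assms(1) unfolding recursive2_in_def by blast
  have "computes X (Mu p) [n] (LEAST x. f x n = 0)" (is "computes _ _ _ ?l") for n
  proof (rule computes.mu)
    show "computes X p [?l, n] 0"
      using p[of ?l n] LeastI_ex[OF assms(2), of n] by simp
  next
    fix m assume "m < ?l"
    then have "f m n \<noteq> 0"
      using not_less_Least by blast
    then show "\<exists>k. computes X p [m, n] (Suc k)"
      using p[of m n] by (metis not0_implies_Suc)
  qed
  then show ?thesis
    unfolding recursive_in_def by blast
qed

section \<open>Cantor pairing and its projections\<close>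

lemma recursive_in_triangle: "recursive_in X triangle"
proof -
  have "recursive2_in X (\<lambda>n y. y + Suc n)"
    by (intro recursive2_in_comp2[OF recursive2_in_add] recursive2_in_snd
        recursive2_in_comp1[OF recursive_in_Suc[OF recursive_in_id]] recursive2_in_fst)
  moreover have "rec_nat 0 (\<lambda>n y. y + Suc n) = triangle"
  proof
    show "rec_nat 0 (\<lambda>n y. y + Suc n) n = triangle n" for n
      by (induction n) auto
  qed
  ultimately show ?thesis
    using recursive_in_rec_nat by metis
qed

lemma recursive2_in_pair: "recursive2_in X pair"
proof -
  have "recursive2_in X (\<lambda>m n. triangle (m + n) + m)"
    by (intro recursive2_in_comp2[OF recursive2_in_add] recursive2_in_fst recursive2_in_add
        recursive2_in_comp1[OF recursive_in_triangle])
  then show ?thesis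
    by (simp add: prod_encode_def)
qed

lemmas recursive_in_pair = recursive2_in_comp[OF recursive2_in_pair]

lemma triangle_mono: "m \<le> n \<Longrightarrow> triangle m \<le> triangle n"
  by (induction rule: dec_induct) auto

text \<open>Since \<open>pair a b = triangle (a + b) + a\<close>, the sum of the components is the
  least \<open>x\<close> with \<open>n < triangle (Suc x)\<close>; truncated subtraction turns this
  inequality into an equation with zero, as minimisation requires.\<close>

lemma recursive_in_pfst_plus_psnd: "recursive_in X (\<lambda>n. pfst n + psnd n)"
proof -
  have "recursive2_in X (\<lambda>x n. Suc n - triangle (Suc x))"
    by (intro recursive2_in_comp2[OF recursive2_in_diff] recursive2_in_snd recursive2_in_fst
        recursive2_in_comp1[OF recursive_in_Suc[OF recursive_in_id]]
        recursive2_in_comp1[OF recursive_in_triangle])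
  moreover have "\<exists>x. Suc n - triangle (Suc x) = 0" for n
    by (rule exI[of _ n]) (simp add: triangle_def)
  ultimately have "recursive_in X (\<lambda>n. LEAST x. Suc n - triangle (Suc x) = 0)"
    by (rule recursive_in_Least)
  moreover have "(LEAST x. Suc n - triangle (Suc x) = 0) = pfst n + psnd n" for n
  proof -
    obtain a b where n: "n = prod_encode (a, b)"
      by (metis prod_decode_inverse surj_pair)
    have "(LEAST x. Suc n - triangle (Suc x) = 0) = a + b"
    proof (rule Least_equality)
      show "Suc n - triangle (Suc (a + b)) = 0"
        by (simp add: n prod_encode_def)
    next
      fix y assume y: "Suc n - triangle (Suc y) = 0"
      show "a + b \<le> y"
      proof (rule ccontr)
        assume "\<not> a + b \<le> y"
        then have "triangle (Suc y) \<le> triangle (a + b)"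
          by (intro triangle_mono) simp
        with y show False
          by (simp add: n prod_encode_def)
      qed
    qed
    then show ?thesis
      by (simp add: n)
  qed
  ultimately show ?thesis by simp
qed

lemma recursive_in_pfst:
  assumes "recursive_in X f" shows "recursive_in X (\<lambda>n. pfst (f n))"
proof -
  have "n - triangle (pfst n + psnd n) = pfst n" for n
  proof -
    have "pair (pfst n) (psnd n) = triangle (pfst n + psnd n) + pfst n"
      by (simp only: prod_encode_def prod.case)
    then show ?thesis
      by simp
  qed
  with recursive_in_diff[OF recursive_in_id
      recursive_in_comp[OF recursive_in_triangle recursive_in_pfst_plus_psnd]]
  have "recursive_in X pfst"
    by (rule recursive_in_cong)
  from recursive_in_comp[OF this assms] show ?thesis .
qed

lemma recursive_in_psnd:
  assumes "recursive_in X f" shows "recursive_in X (\<lambda>n. psnd (f n))"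
proof -
  have "recursive_in X psnd"
    by (rule recursive_in_cong[OF recursive_in_diff[OF recursive_in_pfst_plus_psnd
            recursive_in_pfst[OF recursive_in_id]]]) simp
  from recursive_in_comp[OF this assms] show ?thesis .
qed

section \<open>Case distinctions and decidable predicates\<close>

lemma recursive_in_cases:
  assumes "recursive_in X c" "recursive_in X f" "recursive_in X g"
  shows "recursive_in X (\<lambda>n. if c n = 0 then g n else f n)"
proof -
  obtain p q where p: "\<And>n. computes X p [n] (g n)" and q: "\<And>n. computes X q [n] (f n)"
    using assms(2,3) unfolding recursive_in_def by blast
  \<comment> \<open>The recursion step ignores counter and previous value; \<open>Proj 2\<close>
    recovers the parameter \<open>n\<close>.\<close>
  have "computes X (PrimRec p (Comp q [Proj 2])) [b, n] (if b = 0 then g n else f n)" for b n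
  proof (induction b)
    case 0
    then show ?case
      by (simp add: computes.primrec_0 p)
  next
    case (Suc b)
    have "computes X (Comp q [Proj 2]) [b, if b = 0 then g n else f n, n] (f n)"
      by (rule computes_Comp1[OF _ q]) (simp add: computes_Proj)
    with Suc show ?case
      using computes.primrec_Suc by fastforce
  qed
  then have "recursive2_in X (\<lambda>b n. if b = 0 then g n else f n)"
    unfolding recursive2_in_def by blast
  from recursive2_in_comp[OF this assms(1) recursive_in_id] show ?thesis .
qed

lemma recursive_in_if:
  assumes "decidable_in X P" "recursive_in X f" "recursive_in X g"
  shows "recursive_in X (\<lambda>n. if P n then f n else g n)"
  by (rule recursive_in_cong[OF recursive_in_cases[OF assms]]) simp

lemma decidable_in_not:
  assumes "decidable_in X P" shows "decidable_in X (\<lambda>n. \<not> P n)"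
  by (rule recursive_in_cong[OF recursive_in_if[OF assms recursive_in_const[of _ 0]
          recursive_in_const[of _ 1]]]) simp

lemma decidable_in_conj:
  assumes "decidable_in X P" "decidable_in X Q" shows "decidable_in X (\<lambda>n. P n \<and> Q n)"
  by (rule recursive_in_cong[OF recursive_in_if[OF assms recursive_in_const[of _ 0]]]) simp

lemma decidable_in_disj:
  assumes "decidable_in X P" "decidable_in X Q" shows "decidable_in X (\<lambda>n. P n \<or> Q n)"
  by (rule recursive_in_cong[OF decidable_in_not[OF decidable_in_conj[OF
            assms[THEN decidable_in_not]]]]) simp

lemma decidable_in_imp:
  assumes "decidable_in X P" "decidable_in X Q" shows "decidable_in X (\<lambda>n. P n \<longrightarrow> Q n)"
  by (rule recursive_in_cong[OF decidable_in_disj[OF decidable_in_not[OF assms(1)] assms(2)]])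
    simp

lemma decidable_in_iff:
  assumes "decidable_in X P" "decidable_in X Q" shows "decidable_in X (\<lambda>n. P n \<longleftrightarrow> Q n)"
  by (rule recursive_in_cong[OF decidable_in_conj[OF decidable_in_imp[OF assms]
          decidable_in_imp[OF assms(2,1)]]]) (auto intro!: arg_cong[where f = of_bool])

lemma decidable_in_le:
  assumes "recursive_in X f" "recursive_in X g" shows "decidable_in X (\<lambda>n. f n \<le> g n)"
  by (rule recursive_in_cong[OF recursive_in_cases[OF recursive_in_diff[OF assms]
          recursive_in_const[of _ 0] recursive_in_const[of _ 1]]]) simp

lemma decidable_in_less:
  assumes "recursive_in X f" "recursive_in X g" shows "decidable_in X (\<lambda>n. f n < g n)"
  using decidable_in_not[OF decidable_in_le[OF assms(2,1)]] by (simp add: not_le)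

lemma decidable_in_eq:
  assumes "recursive_in X f" "recursive_in X g" shows "decidable_in X (\<lambda>n. f n = g n)"
  by (rule recursive_in_cong[OF decidable_in_conj[OF decidable_in_le[OF assms]
          decidable_in_le[OF assms(2,1)]]]) auto

lemma decidable_in_const: "decidable_in X (\<lambda>n. P)"
  by (rule recursive_in_const)

lemma decidable_in_oracle:
  assumes "recursive_in X f" shows "decidable_in X (\<lambda>n. f n \<in> X)"
proof -
  have "decidable_in X (\<lambda>n. n \<in> X)"
    unfolding recursive_in_def using computes.query by blast
  from recursive_in_comp[OF this assms] show ?thesis .
qed

lemma decidable_in_finite:
  assumes "finite F" "recursive_in X f" shows "decidable_in X (\<lambda>n. f n \<in> F)"
  using assms(1)
proof (induction F)
  case empty
  show ?case
    using decidable_in_const[of X False] by simp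
next
  case (insert a F)
  show ?case
    using decidable_in_disj[OF decidable_in_eq[OF assms(2) recursive_in_const[of _ a]] insert.IH]
    by simp
qed

section \<open>Primitive recursion with a parameter, and bounded quantifiers\<close>

lemma recursive_in_primrec:
  assumes "recursive_in X g" "recursive_in X (\<lambda>e. h (pfst e) (pfst (psnd e)) (psnd (psnd e)))"
    "recursive_in X k"
  shows "recursive_in X (\<lambda>n. rec_nat (g n) (\<lambda>i y. h i y n) (k n))"
proof -
  obtain p q r where p: "\<And>n. computes X p [n] (g n)"
    and q: "\<And>e. computes X q [e] (h (pfst e) (pfst (psnd e)) (psnd (psnd e)))"
    and r: "\<And>m n. computes X r [m, n] (pair m n)"
    using assms(1,2) recursive2_in_pair unfolding recursive_in_def recursive2_in_def by blast
  let ?s = "Comp q [Comp r [Proj 0, Comp r [Proj 1, Proj 2]]]"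
  have s: "computes X ?s [i, y, n] (h i y n)" for i y n
  proof (rule computes_Comp1)
    show "computes X (Comp r [Proj 0, Comp r [Proj 1, Proj 2]]) [i, y, n] (pair i (pair y n))"
      by (intro computes_Comp2[OF _ _ r] computes_Proj) auto
    show "computes X q [pair i (pair y n)] (h i y n)"
      using q[of "pair i (pair y n)"] by simp
  qed
  have "computes X (PrimRec p ?s) [m, n] (rec_nat (g n) (\<lambda>i y. h i y n) m)" for m n
    by (induction m) (auto intro: computes.primrec_0 computes.primrec_Suc p s[simplified])
  then have "recursive2_in X (\<lambda>m n. rec_nat (g n) (\<lambda>i y. h i y n) m)"
    unfolding recursive2_in_def by blast
  from recursive2_in_comp[OF this assms(3) recursive_in_id] show ?thesis .
qed

text \<open>The truth value of the conjunction over \<open>i < m\<close> is accumulated by recursion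
  on \<open>m\<close>, starting from 1 for the empty conjunction.\<close>

lemma decidable_in_all_less:
  assumes "decidable_in X (\<lambda>e. P (pfst e) (psnd e))" "recursive_in X b"
  shows "decidable_in X (\<lambda>n. \<forall>i<b n. P i n)"
proof -
  have *: "recursive_in X (\<lambda>e. of_bool (pfst (psnd e) \<noteq> 0 \<and> P (pfst e) (psnd (psnd e))))"
  proof (intro decidable_in_conj decidable_in_not decidable_in_eq recursive_in_pfst
      recursive_in_psnd recursive_in_id recursive_in_const)
    show "decidable_in X (\<lambda>e. P (pfst e) (psnd (psnd e)))"
      using recursive_in_comp[OF assms(1), of "\<lambda>e. pair (pfst e) (psnd (psnd e))"]
      by (simp add: recursive_in_pair recursive_in_pfst recursive_in_psnd recursive_in_id)
  qed
  have "rec_nat 1 (\<lambda>i y. of_bool (y \<noteq> 0 \<and> P i n)) m = of_bool (\<forall>i<m. P i n)" for m n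
    by (induction m) (auto simp: less_Suc_eq)
  then show ?thesis
    by (rule recursive_in_cong[OF recursive_in_primrec[OF recursive_in_const[of _ 1] * assms(2)]])
qed

lemma decidable_in_ex_less:
  assumes "decidable_in X (\<lambda>e. P (pfst e) (psnd e))" "recursive_in X b"
  shows "decidable_in X (\<lambda>n. \<exists>i<b n. P i n)"
  using decidable_in_not[OF decidable_in_all_less[OF decidable_in_not[OF assms(1)] assms(2)]]
  by simp

lemma recursive_in_funpow:
  assumes "recursive_in X h" "recursive_in X k" "recursive_in X g"
  shows "recursive_in X (\<lambda>n. (h ^^ k n) (g n))"
proof -
  have "rec_nat a (\<lambda>i. h) m = (h ^^ m) a" for m a
    by (induction m) auto
  moreover have "recursive_in X (\<lambda>e. h (pfst (psnd e)))"
    by (intro recursive_in_comp[OF assms(1)] recursive_in_pfst recursive_in_psnd recursive_in_id)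
  ultimately show ?thesis
    using recursive_in_primrec[OF assms(3) _ assms(2), of "\<lambda>i y n. h y"] by simp
qed

section \<open>Codes of finite sets and of lists\<close>

lemma recursive_in_half: "recursive_in X (\<lambda>n. n div 2)"
proof -
  \<comment> \<open>This rests on the recursion \<open>Suc n div 2 = n - n div 2\<close>.\<close>
  have "rec_nat 0 (-) n = n div 2" for n :: nat
    by (induction n) auto
  then have "rec_nat 0 (-) = (\<lambda>n::nat. n div 2)"
    by blast
  then show ?thesis
    using recursive_in_rec_nat[OF recursive2_in_diff] by metis
qed

text \<open>The code is read in binary: membership of \<open>x\<close> means that the code is odd
  after \<open>x\<close> halvings, and oddness is tested by doubling the half.\<close>

lemma decidable_in_set_decode:
  assumes "recursive_in X f" "recursive_in X g"
  shows "decidable_in X (\<lambda>n. f n \<in> set_decode (g n))"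
proof -
  have "((\<lambda>n. n div 2) ^^ k) m = m div 2 ^ k" for k m :: nat
    by (induction k) (auto simp: div_mult2_eq mult.commute[of 2])
  then have "recursive_in X (\<lambda>n. g n div 2 ^ f n)"
    using recursive_in_funpow[OF recursive_in_half assms] by simp
  then have "decidable_in X (\<lambda>n. g n div 2 ^ f n \<noteq> g n div 2 ^ f n div 2 + g n div 2 ^ f n div 2)"
    by (intro decidable_in_not decidable_in_eq recursive_in_add
        recursive_in_comp[OF recursive_in_half]) auto
  moreover have "odd n \<longleftrightarrow> n \<noteq> n div 2 + n div 2" for n :: nat
    by presburger
  ultimately show ?thesis
    by (simp add: set_decode_def)
qed

lemma recursive_in_power2:
  assumes "recursive_in X f" shows "recursive_in X (\<lambda>n. 2 ^ f n)"
proof -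
  have "((\<lambda>n. n + n) ^^ k) 1 = (2::nat) ^ k" for k
    by (induction k) auto
  then show ?thesis
    using recursive_in_funpow[OF recursive_in_add[OF recursive_in_id recursive_in_id] assms
        recursive_in_const[of _ 1]] by simp
qed

lemma list_decode_Suc_pair [simp]: "list_decode (Suc (pair x l)) = x # list_decode l"
  by (metis list_decode_inverse list_encode.simps(2) list_encode_inverse)

text \<open>\<open>list_encode\<close> maps \<open>x # xs\<close> to
  \<open>Suc (pair x (list_encode xs))\<close>, so \<open>pfst (l - 1)\<close> is the head and
  \<open>psnd (l - 1)\<close> codes the tail.\<close>

definition nth_code :: "nat \<Rightarrow> nat \<Rightarrow> nat" where
  "nth_code l i = pfst (((\<lambda>l. psnd (l - 1)) ^^ i) l - 1)"

lemma nth_code_list_encode: "i < length xs \<Longrightarrow> nth_code (list_encode xs) i = xs ! i"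
proof (induction i arbitrary: xs)
  case 0
  then show ?case
    by (cases xs) (auto simp: nth_code_def)
next
  case (Suc i)
  then show ?case
    by (cases xs) (auto simp: nth_code_def funpow_Suc_right simp del: funpow.simps)
qed

lemma recursive_in_nth_code:
  assumes "recursive_in X f" "recursive_in X g"
  shows "recursive_in X (\<lambda>n. nth_code (f n) (g n))"
  unfolding nth_code_def
  by (intro recursive_in_pfst recursive_in_pred recursive_in_funpow assms recursive_in_psnd
      recursive_in_id)

section \<open>Transitivity of Turing reducibility, by replacing oracle queries with a
  program\<close>

primrec subst_query :: "code \<Rightarrow> code \<Rightarrow> code" where
  "subst_query r Zero = Zero"
| "subst_query r Succ = Succ"
| "subst_query r (Proj i) = Proj i"
| "subst_query r Query = r"
| "subst_query r (Comp p qs) = Comp (subst_query r p) (map (subst_query r) qs)"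
| "subst_query r (PrimRec p q) = PrimRec (subst_query r p) (subst_query r q)"
| "subst_query r (Mu p) = Mu (subst_query r p)"

lemma computes_subst_query:
  assumes "computes Y p xs y" "\<And>n. computes X r [n] (of_bool (n \<in> Y))"
  shows "computes X (subst_query r p) xs y"
  using assms(1)
proof (induction rule: computes.induct)
  case (comp xs qs ys p z)
  from comp(1) have "list_all2 (\<lambda>q y. computes X q xs y) (map (subst_query r) qs) ys"
    by (auto simp: list_all2_conv_all_nth)
  with comp show ?case
    by (auto intro: computes.comp)
next
  case (mu p n xs)
  show ?case
    unfolding subst_query.simps by (rule computes.mu) (use mu in blast)+
qed (use assms(2) in \<open>auto intro: computes.intros\<close>)

lemma turing_reducible_trans: "D \<le>\<^sub>T Y \<Longrightarrow> Y \<le>\<^sub>T X \<Longrightarrow> D \<le>\<^sub>T X"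
  unfolding turing_reducible_def by (meson computes_subst_query)

section \<open>Semidecidable predicates\<close>

text \<open>
  Monotonicity in the stage makes semidecidable predicates closed under bounded universal
  quantification.
\<close>

definition approximates :: "nat set \<Rightarrow> (nat \<Rightarrow> nat \<Rightarrow> bool) \<Rightarrow> (nat \<Rightarrow> bool) \<Rightarrow> bool" where
  "approximates X Q P \<longleftrightarrow> (\<forall>s t n. s \<le> t \<longrightarrow> Q s n \<longrightarrow> Q t n)
     \<and> decidable_in X (\<lambda>e. Q (pfst e) (psnd e)) \<and> (\<forall>n. P n \<longleftrightarrow> (\<exists>s. Q s n))"

definition semidecidable_in :: "nat set \<Rightarrow> (nat \<Rightarrow> bool) \<Rightarrow> bool" where
  "semidecidable_in X P \<longleftrightarrow> (\<exists>Q. approximates X Q P)"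

lemma approximatesD:
  assumes "approximates X Q P"
  shows "s \<le> t \<Longrightarrow> Q s n \<Longrightarrow> Q t n" "decidable_in X (\<lambda>e. Q (pfst e) (psnd e))"
    "P n \<longleftrightarrow> (\<exists>s. Q s n)"
  using assms unfolding approximates_def by blast+

lemma semidecidable_inI:
  assumes "\<And>s t n. s \<le> t \<Longrightarrow> Q s n \<Longrightarrow> Q t n" "decidable_in X (\<lambda>e. Q (pfst e) (psnd e))"
    "\<And>n. P n \<longleftrightarrow> (\<exists>s. Q s n)"
  shows "semidecidable_in X P"
  using assms unfolding semidecidable_in_def approximates_def by blast

lemma recursive_in_comp_pair:
  assumes "recursive_in X (\<lambda>e. f (pfst e) (psnd e))" "recursive_in X a" "recursive_in X b"
  shows "recursive_in X (\<lambda>n. f (a n) (b n))"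
  using recursive_in_comp[OF assms(1) recursive_in_pair[OF assms(2,3)]] by simp

lemma semidecidable_in_decidable: "decidable_in X P \<Longrightarrow> semidecidable_in X P"
  by (rule semidecidable_inI[of "\<lambda>s. P"])
    (auto dest: recursive_in_comp[OF _ recursive_in_psnd[OF recursive_in_id]])

lemma semidecidable_in_conj:
  assumes "semidecidable_in X P" "semidecidable_in X Q"
  shows "semidecidable_in X (\<lambda>n. P n \<and> Q n)"
proof -
  obtain P' where "approximates X P' P"
    using assms(1) unfolding semidecidable_in_def by blast
  note P' = approximatesD[OF this]
  obtain Q' where "approximates X Q' Q"
    using assms(2) unfolding semidecidable_in_def by blast
  note Q' = approximatesD[OF this]
  show ?thesis
  proof (rule semidecidable_inI[where Q = "\<lambda>s n. P' s n \<and> Q' s n"])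
    show "decidable_in X (\<lambda>e. P' (pfst e) (psnd e) \<and> Q' (pfst e) (psnd e))"
      by (intro decidable_in_conj P' Q')
    show "P n \<and> Q n \<longleftrightarrow> (\<exists>s. P' s n \<and> Q' s n)" for n
      unfolding P'(3) Q'(3) using P'(1) Q'(1) by (meson nat_le_linear)
  qed (use P'(1) Q'(1) in blast)
qed

lemma semidecidable_in_disj:
  assumes "semidecidable_in X P" "semidecidable_in X Q"
  shows "semidecidable_in X (\<lambda>n. P n \<or> Q n)"
proof -
  obtain P' where "approximates X P' P"
    using assms(1) unfolding semidecidable_in_def by blast
  note P' = approximatesD[OF this]
  obtain Q' where "approximates X Q' Q"
    using assms(2) unfolding semidecidable_in_def by blast
  note Q' = approximatesD[OF this]
  show ?thesis
  proof (rule semidecidable_inI[where Q = "\<lambda>s n. P' s n \<or> Q' s n"])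
    show "decidable_in X (\<lambda>e. P' (pfst e) (psnd e) \<or> Q' (pfst e) (psnd e))"
      by (intro decidable_in_disj P' Q')
    show "P n \<or> Q n \<longleftrightarrow> (\<exists>s. P' s n \<or> Q' s n)" for n
      unfolding P'(3) Q'(3) by blast
  qed (use P'(1) Q'(1) in blast)
qed

lemma semidecidable_in_ex:
  assumes "semidecidable_in X (\<lambda>e. P (pfst e) (psnd e))"
  shows "semidecidable_in X (\<lambda>n. \<exists>i. P i n)"
proof -
  obtain Q where "approximates X Q (\<lambda>e. P (pfst e) (psnd e))"
    using assms unfolding semidecidable_in_def by blast
  note Q = approximatesD[OF this]
  show ?thesis
  \<comment> \<open>The stage \<open>s\<close> also bounds the search for the witness, which keeps
    the approximation decidable.\<close>
  proof (rule semidecidable_inI[where Q = "\<lambda>s n. \<exists>i<s. Q s (pair i n)"])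
    show "decidable_in X (\<lambda>e. \<exists>i<pfst e. Q (pfst e) (pair i (psnd e)))"
      by (intro decidable_in_ex_less recursive_in_comp_pair[OF Q(2)] recursive_in_pair
          recursive_in_pfst recursive_in_psnd recursive_in_id)
    show "(\<exists>i. P i n) \<longleftrightarrow> (\<exists>s. \<exists>i<s. Q s (pair i n))" for n
    proof
      assume "\<exists>i. P i n"
      then obtain i s where "Q s (pair i n)"
        using Q(3)[of "pair _ n"] by auto
      then have "Q (max s (Suc i)) (pair i n)"
        using Q(1) by (meson max.cobounded1)
      then show "\<exists>s. \<exists>i<s. Q s (pair i n)"
        by (meson lessI less_max_iff_disj)
    next
      assume "\<exists>s. \<exists>i<s. Q s (pair i n)"
      then show "\<exists>i. P i n"
        using Q(3)[of "pair _ n"] by auto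
    qed
    show "\<exists>i<t. Q t (pair i n)" if "s \<le> t" "\<exists>i<s. Q s (pair i n)" for s t n
      using that Q(1) by (meson order_less_le_trans)
  qed
qed

text \<open>Finitely many stages have a maximum. This serves bounded quantifiers, the use of a
  computation and compactness alike.\<close>

lemma ex_uniform_bound:
  assumes "\<And>i s t. s \<le> t \<Longrightarrow> Q i s \<Longrightarrow> Q i t" "\<And>i. i < m \<Longrightarrow> \<exists>s. Q i s"
  shows "\<exists>s::nat. \<forall>i<m::nat. Q i s"
  using assms(2)
proof (induction m)
  case (Suc m)
  then obtain s t where "\<forall>i<m. Q i s" "Q m t"
    by (meson lessI less_Suc_eq)
  then have "\<forall>i<Suc m. Q i (max s t)"
    using assms(1)[of s "max s t"] assms(1)[of t "max s t"] by (auto simp: less_Suc_eq)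
  then show ?case by blast
qed simp

lemma semidecidable_in_all_less:
  assumes "semidecidable_in X (\<lambda>e. P (pfst e) (psnd e))" "recursive_in X b"
  shows "semidecidable_in X (\<lambda>n. \<forall>i<b n. P i n)"
proof -
  obtain Q where "approximates X Q (\<lambda>e. P (pfst e) (psnd e))"
    using assms(1) unfolding semidecidable_in_def by blast
  note Q = approximatesD[OF this]
  show ?thesis
  proof (rule semidecidable_inI[where Q = "\<lambda>s n. \<forall>i<b n. Q s (pair i n)"])
    show "decidable_in X (\<lambda>e. \<forall>i<b (psnd e). Q (pfst e) (pair i (psnd e)))"
      by (intro decidable_in_all_less recursive_in_comp_pair[OF Q(2)] recursive_in_pair
          recursive_in_pfst recursive_in_psnd recursive_in_id recursive_in_comp[OF assms(2)])
    show "(\<forall>i<b n. P i n) \<longleftrightarrow> (\<exists>s. \<forall>i<b n. Q s (pair i n))" for n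
    proof
      assume "\<forall>i<b n. P i n"
      then have "\<exists>s. Q s (pair i n)" if "i < b n" for i
        using that Q(3)[of "pair i n"] by auto
      then show "\<exists>s. \<forall>i<b n. Q s (pair i n)"
        using ex_uniform_bound[of "\<lambda>i s. Q s (pair i n)"] Q(1) by meson
    next
      assume "\<exists>s. \<forall>i<b n. Q s (pair i n)"
      then show "\<forall>i<b n. P i n"
        using Q(3)[of "pair _ n"] by auto
    qed
  qed (use Q(1) in blast)
qed

lemma semidecidable_in_comp:
  assumes "semidecidable_in X P" "recursive_in X f"
  shows "semidecidable_in X (\<lambda>n. P (f n))"
proof -
  obtain Q where "approximates X Q P"
    using assms(1) unfolding semidecidable_in_def by blast
  note Q = approximatesD[OF this]
  show ?thesis
  proof (rule semidecidable_inI[where Q = "\<lambda>s n. Q s (f n)"])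
    show "decidable_in X (\<lambda>e. Q (pfst e) (f (psnd e)))"
      by (intro recursive_in_comp_pair[OF Q(2)] recursive_in_pfst recursive_in_psnd recursive_in_id
          recursive_in_comp[OF assms(2)])
  qed (use Q in blast)+
qed

text \<open>Pairs \<open>w\<close> of a stage and a value are searched until the value is enumerated
  for \<open>n\<close> at that stage. The search ends because a value exists, and only the right one
  is ever enumerated.\<close>

lemma turing_reducible_if_semidecidable_graph:
  assumes "semidecidable_in X (\<lambda>e. R (pfst e) (psnd e))"
    and "\<And>n k. R n k \<longleftrightarrow> k = of_bool (n \<in> D)"
  shows "D \<le>\<^sub>T X"
proof -
  obtain Q where "approximates X Q (\<lambda>e. R (pfst e) (psnd e))"
    using assms(1) unfolding semidecidable_in_def by blast
  note Q = approximatesD[OF this]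
  define S where "S w n \<longleftrightarrow> Q (pfst w) (pair n (psnd w))" for w n
  have S: "R n k \<longleftrightarrow> (\<exists>w. S w n \<and> psnd w = k)" for n k
    using Q(3)[of "pair n k"] by (auto simp: S_def intro: exI[of _ "pair _ _"])
  have "decidable_in X (\<lambda>e. \<not> S (pfst e) (psnd e))"
    unfolding S_def
    by (intro decidable_in_not recursive_in_comp_pair[OF Q(2)] recursive_in_pfst recursive_in_psnd
        recursive_in_pair recursive_in_id)
  from recursive2_in_comp1[OF this recursive2_in_pair]
  have "recursive2_in X (\<lambda>w n. of_bool (\<not> S w n))"
    by simp
  moreover have ex: "\<exists>w. of_bool (\<not> S w n) = (0::nat)" for n
    using S[of n "of_bool (n \<in> D)"] assms(2)[of n] by auto
  ultimately have "recursive_in X (\<lambda>n. LEAST w. of_bool (\<not> S w n) = (0::nat))"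
    by (rule recursive_in_Least)
  then have "recursive_in X (\<lambda>n. psnd (LEAST w. of_bool (\<not> S w n) = (0::nat)))"
    by (rule recursive_in_psnd)
  moreover have "psnd (LEAST w. of_bool (\<not> S w n) = (0::nat)) = of_bool (n \<in> D)" for n
  proof -
    have "S (LEAST w. of_bool (\<not> S w n) = (0::nat)) n"
      using LeastI_ex[OF ex, of n] by simp
    then show ?thesis
      using S assms(2) by blast
  qed
  ultimately show ?thesis
    unfolding turing_reducible_iff by (rule recursive_in_cong)
qed

section \<open>Evaluation from finitely much of the oracle\<close>

text \<open>
  \<open>eval Q p xs y\<close> is the analogue of \<open>computes\<close> for a partial oracle: \<open>Q x y\<close> means that the
  answer to the query \<open>x\<close> is known to be \<open>y\<close>. The sequence \<open>w\<close> in the clause for primitive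
  recursion lists the intermediate values.
\<close>

primrec eval :: "(nat \<Rightarrow> nat \<Rightarrow> bool) \<Rightarrow> code \<Rightarrow> nat list \<Rightarrow> nat \<Rightarrow> bool" where
  "eval Q Zero = (\<lambda>xs y. y = 0)"
| "eval Q Succ = (\<lambda>xs y. \<exists>x. xs = [x] \<and> y = Suc x)"
| "eval Q (Proj i) = (\<lambda>xs y. i < length xs \<and> y = xs ! i)"
| "eval Q Query = (\<lambda>xs y. \<exists>x. xs = [x] \<and> Q x y)"
| "eval Q (Comp p qs) =
    (\<lambda>xs z. \<exists>ys. list_all2 (\<lambda>f y. f xs y) (map (eval Q) qs) ys \<and> eval Q p ys z)"
| "eval Q (PrimRec p q) = (\<lambda>xs y. \<exists>n zs w. xs = n # zs \<and> eval Q p zs (w 0) \<and>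
    (\<forall>i<n. eval Q q (i # w i # zs) (w (Suc i))) \<and> y = w n)"
| "eval Q (Mu p) = (\<lambda>xs n. eval Q p (n # xs) 0 \<and> (\<forall>m<n. \<exists>k. eval Q p (m # xs) (Suc k)))"

text \<open>Queries at or above \<open>m\<close> get no answer, so a successful evaluation depends
  only on the first \<open>m\<close> bits of \<open>Z\<close>.\<close>

definition restrict_oracle :: "nat \<Rightarrow> nat set \<Rightarrow> nat \<Rightarrow> nat \<Rightarrow> bool" where
  "restrict_oracle m Z x y \<longleftrightarrow> x < m \<and> y = of_bool (x \<in> Z)"

lemma eval_mono:
  assumes "\<And>x y. Q x y \<Longrightarrow> Q' x y" "eval Q p xs y" shows "eval Q' p xs y"
  using assms(2)
proof (induction p arbitrary: xs y)
  case (Comp p qs)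
  then obtain ys where ys: "list_all2 (\<lambda>f y. f xs y) (map (eval Q) qs) ys" "eval Q p ys y"
    by auto
  have "list_all2 (\<lambda>f y. f xs y) (map (eval Q') qs) ys"
    using ys(1) Comp.IH(2) by (auto simp: list_all2_conv_all_nth)
  with ys Comp.IH(1) show ?case by auto
next
  case (PrimRec p q)
  from PrimRec.prems obtain n zs w where "xs = n # zs" "eval Q p zs (w 0)"
    "\<forall>i<n. eval Q q (i # w i # zs) (w (Suc i))" "y = w n"
    by auto
  with PrimRec.IH show ?case
    by (auto intro!: exI[of _ w])
next
  case (Mu p)
  then show ?case by simp meson
qed (use assms(1) in auto)

lemma computes_if_eval:
  assumes "eval Q p xs y" "\<And>x y. Q x y \<Longrightarrow> y = of_bool (x \<in> Z)"
  shows "computes Z p xs y"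
  using assms(1)
proof (induction p arbitrary: xs y)
  case Query
  then show ?case
    using assms(2) computes.query by auto
next
  case (Comp p qs)
  then obtain ys where ys: "list_all2 (\<lambda>f y. f xs y) (map (eval Q) qs) ys" "eval Q p ys y"
    by auto
  have "list_all2 (\<lambda>q y. computes Z q xs y) qs ys"
    using ys(1) Comp.IH(2) by (auto simp: list_all2_conv_all_nth)
  with ys Comp.IH(1) show ?case
    by (auto intro: computes.comp)
next
  case (PrimRec p q)
  then obtain n zs w where w: "xs = n # zs" "eval Q p zs (w 0)"
    "\<forall>i<n. eval Q q (i # w i # zs) (w (Suc i))" "y = w n"
    by auto
  \<comment> \<open>Induction along the recorded values \<open>w\<close> rebuilds the recursive
    derivation.\<close>
  have "computes Z (PrimRec p q) (i # zs) (w i)" if "i \<le> n" for i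
    using that
  proof (induction i)
    case 0
    then show ?case
      using w PrimRec.IH(1) by (simp add: computes.primrec_0)
  next
    case (Suc i)
    then show ?case
      using w PrimRec.IH(2) by (auto intro: computes.primrec_Suc)
  qed
  then show ?case
    using w by simp
next
  case (Mu p)
  then show ?case
    by (auto intro!: computes.mu) blast
qed (auto intro: computes.intros)

lemma eval_restrict_oracle_mono:
  "eval (restrict_oracle m Z) p xs y \<Longrightarrow> m \<le> m' \<Longrightarrow> eval (restrict_oracle m' Z) p xs y"
  by (erule eval_mono[rotated]) (simp add: restrict_oracle_def)

lemma restrict_oracle_cong:
  assumes "Z \<inter> {..<m} = Z' \<inter> {..<m}" shows "restrict_oracle m Z = restrict_oracle m Z'"
  unfolding restrict_oracle_def fun_eq_iff using assms by (auto simp: set_eq_iff)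

text \<open>The use principle: both oracles answer the queries below \<open>m\<close> alike.\<close>

lemma computes_if_eval_restrict_oracle:
  assumes "eval (restrict_oracle m Z) p xs y" "Z \<inter> {..<m} = Z' \<inter> {..<m}"
  shows "computes Z' p xs y"
  using assms(1) unfolding restrict_oracle_cong[OF assms(2)]
  by (rule computes_if_eval) (simp add: restrict_oracle_def)

text \<open>A derivation asks only finitely many queries; the bounds for its subcomputations are
  combined by taking a maximum.\<close>

lemma eval_if_computes: "computes Z p xs y \<Longrightarrow> \<exists>m. eval (restrict_oracle m Z) p xs y"
proof (induction rule: computes.induct)
  case (query x)
  have "restrict_oracle (Suc x) Z x (of_bool (x \<in> Z))"
    by (simp add: restrict_oracle_def)
  then show ?case by auto
next
  case (comp xs qs ys p z)
  have "\<exists>m. list_all2 (\<lambda>f y. f xs y) (map (eval (restrict_oracle m Z)) qs) ys"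
  proof -
    have len: "length qs = length ys"
      using comp.IH(1) by (rule list_all2_lengthD)
    have "\<exists>m. eval (restrict_oracle m Z) (qs ! i) xs (ys ! i)" if "i < length ys" for i
      using list_all2_nthD2[OF comp.IH(1) that] by blast
    then have "\<exists>m. \<forall>i<length ys. eval (restrict_oracle m Z) (qs ! i) xs (ys ! i)"
      by (intro ex_uniform_bound) (auto intro: eval_restrict_oracle_mono)
    then show ?thesis
      using len by (auto simp: list_all2_conv_all_nth)
  qed
  then obtain m where m: "list_all2 (\<lambda>f y. f xs y) (map (eval (restrict_oracle m Z)) qs) ys"
    by blast
  obtain m' where m': "eval (restrict_oracle m' Z) p ys z"
    using comp.IH(2) by blast
  have "list_all2 (\<lambda>f y. f xs y) (map (eval (restrict_oracle (max m m') Z)) qs) ys"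
    using m by (auto simp: list_all2_conv_all_nth intro: eval_restrict_oracle_mono[of m])
  moreover have "eval (restrict_oracle (max m m') Z) p ys z"
    using m' by (rule eval_restrict_oracle_mono) simp
  ultimately show ?case by auto
next
  case (primrec_0 p xs y q)
  then obtain m where "eval (restrict_oracle m Z) p xs y" by blast
  then show ?case
    by (auto intro!: exI[of _ m] exI[of _ "\<lambda>_. y"])
next
  case (primrec_Suc p q n xs y z)
  then obtain m m' where m: "eval (restrict_oracle m Z) (PrimRec p q) (n # xs) y"
    and m': "eval (restrict_oracle m' Z) q (n # y # xs) z" by blast
  let ?E = "eval (restrict_oracle (max m m') Z)"
  have "?E (PrimRec p q) (n # xs) y"
    using m by (rule eval_restrict_oracle_mono) simp
  then obtain w where w: "?E p xs (w 0)" "\<forall>i<n. ?E q (i # w i # xs) (w (Suc i))" "y = w n"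
    by auto
  have "?E q (n # y # xs) z"
    using m' by (rule eval_restrict_oracle_mono) simp
  with w have "?E (PrimRec p q) (Suc n # xs) z"
    by (auto simp: less_Suc_eq intro!: exI[of _ "w(Suc n := z)"])
  then show ?case by blast
next
  case (mu p n xs)
  obtain m where m: "eval (restrict_oracle m Z) p (n # xs) 0"
    using mu.IH(1) by blast
  have "\<exists>m. \<forall>i<n. \<exists>k. eval (restrict_oracle m Z) p (i # xs) (Suc k)"
    using mu.IH(2) by (intro ex_uniform_bound) (blast intro: eval_restrict_oracle_mono)+
  then obtain m' where m': "\<forall>i<n. \<exists>k. eval (restrict_oracle m' Z) p (i # xs) (Suc k)"
    by blast
  have "eval (restrict_oracle (max m m') Z) (Mu p) xs n"
    using m m' eval_restrict_oracle_mono by simp (meson max.cobounded1 max.cobounded2)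
  then show ?case by blast
qed auto

section \<open>Semidecidability of evaluation\<close>

text \<open>Lets a number stand for the sequence \<open>w\<close> in \<open>eval\<close>, of which
  only a finite part is consulted.\<close>

lemma nth_code_surj: "\<exists>l. \<forall>i\<le>n. nth_code l i = w i"
proof (intro exI allI impI)
  fix i assume "i \<le> n"
  then show "nth_code (list_encode (map w [0..<Suc n])) i = w i"
    by (subst nth_code_list_encode) (auto simp del: upt_Suc)
qed

lemmas recursive_intros = recursive_in_const recursive_in_id recursive_in_pfst recursive_in_psnd
  recursive_in_pair recursive_in_Suc recursive_in_nth_code recursive_in_power2

lemma ex_list_decode: "(\<exists>xs. P xs) \<longleftrightarrow> (\<exists>l. P (list_decode l))"
  by (metis list_encode_inverse)

lemma list_decode_eq_Cons: "list_decode l = x # list_decode l' \<longleftrightarrow> l = Suc (pair x l')"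
  by (metis list_decode_Suc_pair list_decode_inverse)

lemma list_decode_eq_Nil: "list_decode l = [] \<longleftrightarrow> l = 0"
  by (metis list_decode.simps(1) list_decode_inverse)

lemma list_decode_eq_singleton: "list_decode l = [x] \<longleftrightarrow> l = Suc (pair x 0)"
  using list_decode_eq_Cons[of l x 0] by simp

text \<open>The parameters are arbitrary recursive functions so that the induction hypotheses apply
  under quantifiers, where they become components of an environment. With lists and sequences coded
  by numbers, each clause of \<open>eval\<close> is built from decidable facts by conjunction,
  existential and bounded universal quantifiers.\<close>

lemma semidecidable_in_eval:
  assumes "recursive_in X m" "recursive_in X a" "recursive_in X l" "recursive_in X y"
  shows "semidecidable_in X (\<lambda>n. eval (restrict_oracle (m n) (set_decode (a n))) p
           (list_decode (l n)) (y n))"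
  using assms
proof (induction p arbitrary: m a l y)
  case Zero
  then show ?case
    by (auto intro!: semidecidable_in_decidable decidable_in_eq recursive_in_const)
next
  case Succ
  show ?case
    unfolding eval.simps list_decode_eq_singleton
    by (intro semidecidable_in_ex semidecidable_in_decidable decidable_in_conj decidable_in_eq
        recursive_intros Succ[THEN recursive_in_comp])
next
  case (Proj i)
  \<comment> \<open>The index \<open>i\<close> is a fixed number, so induction on it can strip the
    coded list one entry at a time.\<close>
  have "semidecidable_in X (\<lambda>n. i < length (list_decode (l n)) \<and> y n = list_decode (l n) ! i)"
    using Proj(3,4)
  proof (induction i arbitrary: l y)
    case 0
    have "0 < length (list_decode l) \<and> z = list_decode l ! 0 \<longleftrightarrow> (\<exists>l'. l = Suc (pair z l'))"
      for l z
      by (cases "list_decode l") (auto simp flip: list_decode_eq_Cons ex_list_decode)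
    then show ?case
      using 0 by (simp only:) (intro semidecidable_in_ex semidecidable_in_decidable decidable_in_eq
          recursive_intros 0[THEN recursive_in_comp])
  next
    case (Suc i)
    have *: "Suc i < length (list_decode l) \<and> z = list_decode l ! Suc i \<longleftrightarrow>
        (\<exists>l' x. l = Suc (pair x l') \<and> i < length (list_decode l') \<and> z = list_decode l' ! i)"
      for l z
      by (cases "list_decode l")
        (auto simp flip: list_decode_eq_Cons ex_list_decode[of "\<lambda>l'. \<exists>x. _ = x # l' \<and> _ l'"],
          metis list_encode_inverse)
    show ?case
      unfolding * by (intro semidecidable_in_ex semidecidable_in_conj semidecidable_in_decidable
          decidable_in_eq Suc.IH recursive_intros Suc.prems[THEN recursive_in_comp])
  qed
  then show ?case by simp
next
  case Query
  show ?case
    unfolding eval.simps list_decode_eq_singleton restrict_oracle_def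
    by (intro semidecidable_in_ex semidecidable_in_decidable decidable_in_conj decidable_in_eq
        decidable_in_less decidable_in_set_decode recursive_intros Query[THEN recursive_in_comp])
next
  case (Comp p qs)
  \<comment> \<open>The list of subprograms is fixed, while the list of their values is coded by
    \<open>y n\<close>; the induction splits off one program and one coded value at a time.\<close>
  have qs: "semidecidable_in X (\<lambda>n. list_all2 (\<lambda>f y. f (list_decode (l n)) y)
      (map (eval (restrict_oracle (m n) (set_decode (a n)))) qs') (list_decode (y n)))"
    if "set qs' \<subseteq> set qs" "recursive_in X m" "recursive_in X a" "recursive_in X l"
      "recursive_in X y" for qs' m a l y
    using that
  proof (induction qs' arbitrary: m a l y)
    case Nil
    then show ?case
      by (auto simp: list_decode_eq_Nil
          intro!: semidecidable_in_decidable decidable_in_eq recursive_in_const)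
  next
    case (Cons q qs')
    have *: "list_all2 R (f # fs) (list_decode z) \<longleftrightarrow>
        (\<exists>x z'. z = Suc (pair x z') \<and> R f x \<and> list_all2 R fs (list_decode z'))"
      for R z and f :: "nat list \<Rightarrow> nat \<Rightarrow> bool" and fs
      by (cases "list_decode z") (auto simp flip: list_decode_eq_Cons, metis list_encode_inverse)
    show ?case
      unfolding list.map *
      by (intro semidecidable_in_ex semidecidable_in_conj semidecidable_in_decidable
          decidable_in_eq Cons.IH Comp.IH(2) recursive_intros Cons.prems(2-)[THEN recursive_in_comp])
        (use Cons.prems(1) in auto)
  qed
  show ?case
    unfolding eval.simps ex_list_decode
    by (intro semidecidable_in_ex semidecidable_in_conj qs Comp.IH(1) recursive_intros
        Comp.prems[THEN recursive_in_comp]) simp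
next
  case (PrimRec p q)
  \<comment> \<open>The function \<open>w\<close> is replaced by a list code, which leaves only
    quantifiers over numbers.\<close>
  have *: "eval Q (PrimRec p q) (list_decode l) y \<longleftrightarrow> (\<exists>k l' w. l = Suc (pair k l') \<and>
     eval Q p (list_decode l') (nth_code w 0) \<and>
     (\<forall>i<k. eval Q q (list_decode (Suc (pair i (Suc (pair (nth_code w i) l')))))
        (nth_code w (Suc i))) \<and> y = nth_code w k)" (is "?L \<longleftrightarrow> ?R") for Q l y
  proof
    assume ?L
    then obtain k zs w where w: "list_decode l = k # zs" "eval Q p zs (w 0)"
      "\<forall>i<k. eval Q q (i # w i # zs) (w (Suc i))" "y = w k"
      by auto
    obtain l' where l': "zs = list_decode l'"
      by (metis list_encode_inverse)
    obtain w' where "\<forall>i\<le>k. nth_code w' i = w i"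
      using nth_code_surj by blast
    with w show ?R
      unfolding l' list_decode_eq_Cons by (intro exI[of _ k] exI[of _ l'] exI[of _ w']) simp
  next
    assume ?R
    then obtain k l' w where "l = Suc (pair k l')" "eval Q p (list_decode l') (nth_code w 0)"
      "\<forall>i<k. eval Q q (list_decode (Suc (pair i (Suc (pair (nth_code w i) l')))))
        (nth_code w (Suc i))" "y = nth_code w k"
      by blast
    then show ?L
      by (auto intro!: exI[of _ "nth_code w"])
  qed
  show ?case
    unfolding * by (intro semidecidable_in_ex semidecidable_in_conj semidecidable_in_all_less
        semidecidable_in_decidable decidable_in_eq PrimRec.IH recursive_intros
        PrimRec.prems[THEN recursive_in_comp])
next
  case (Mu p)
  have *: "eval Q (Mu p) (list_decode l) y \<longleftrightarrow> eval Q p (list_decode (Suc (pair y l))) 0 \<and>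
     (\<forall>i<y. \<exists>k. eval Q p (list_decode (Suc (pair i l))) (Suc k))" for Q l y
    by simp
  show ?case
    unfolding * by (intro semidecidable_in_ex semidecidable_in_conj semidecidable_in_all_less
        Mu.IH recursive_intros Mu.prems[THEN recursive_in_comp] Mu.prems)
qed

lemma semidecidable_in_eval_singleton:
  assumes "recursive_in X m" "recursive_in X a" "recursive_in X x" "recursive_in X y"
  shows "semidecidable_in X (\<lambda>n. eval (restrict_oracle (m n) (set_decode (a n))) p [x n] (y n))"
proof -
  have "[x] = list_decode (Suc (pair x 0))" for x
    by simp
  then show ?thesis
    using assms by (simp only:) (intro semidecidable_in_eval recursive_intros)
qed

section \<open>Cone avoidance for closed sets\<close>

text \<open>
  \<open>W m Z\<close> is meant to depend only on the initial segment \<open>Z \<inter> {..<m}\<close>, so an extension closed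
  \<open>W\<close> describes the open set of all \<open>Z\<close> that satisfy \<open>W m Z\<close> for some \<open>m\<close>.
\<close>

definition extension_closed :: "(nat \<Rightarrow> nat set \<Rightarrow> bool) \<Rightarrow> bool" where
  "extension_closed W \<longleftrightarrow>
     (\<forall>m m' Z Z'. W m Z \<longrightarrow> m \<le> m' \<longrightarrow> Z \<inter> {..<m} = Z' \<inter> {..<m} \<longrightarrow> W m' Z')"

lemma extension_closedD:
  "extension_closed W \<Longrightarrow> W m Z \<Longrightarrow> m \<le> m' \<Longrightarrow> Z \<inter> {..<m} = Z' \<inter> {..<m} \<Longrightarrow> W m' Z'"
  unfolding extension_closed_def by blast

lemma extension_closed_eval:
  "extension_closed (\<lambda>m Z. eval (restrict_oracle m Z) p xs y)"
  unfolding extension_closed_def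
proof (intro allI impI)
  fix m m' Z Z'
  assume "eval (restrict_oracle m Z) p xs y" "m \<le> m'" "Z \<inter> {..<m} = Z' \<inter> {..<m}"
  then show "eval (restrict_oracle m' Z') p xs y"
    using restrict_oracle_cong[of Z m Z'] by (auto intro: eval_restrict_oracle_mono)
qed

lemma extension_closed_disj:
  "extension_closed V \<Longrightarrow> extension_closed W \<Longrightarrow> extension_closed (\<lambda>m Z. V m Z \<or> W m Z)"
  unfolding extension_closed_def by blast

text \<open>Compactness of Cantor space: the initial segments avoiding \<open>W\<close> form a
  binary tree with nodes at every level, and a path is built bit by bit.\<close>

lemma Koenig:
  assumes W: "extension_closed W" and ex: "\<And>m. \<exists>Z. \<not> W m Z"
  shows "\<exists>Z. \<forall>m. \<not> W m Z"
proof -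
  \<comment> \<open>The node \<open>Z \<inter> {..<m}\<close> has avoiding extensions at all levels;
    one of the two next bits preserves this invariant.\<close>
  define ext where "ext m Z \<longleftrightarrow> (\<forall>k. \<exists>Z'. Z' \<inter> {..<m} = Z \<inter> {..<m} \<and> \<not> W k Z')" for m Z
  have "\<exists>Zs. \<forall>m. ext m (Zs m) \<and> Zs (Suc m) \<inter> {..<m} = Zs m \<inter> {..<m}"
  proof (rule dependent_nat_choice)
    show "\<exists>Z. ext 0 Z"
      using ex by (auto simp: ext_def)
  next
    fix Z m assume Z: "ext m Z"
    show "\<exists>Z'. ext (Suc m) Z' \<and> Z' \<inter> {..<m} = Z \<inter> {..<m}"
    \<comment> \<open>If both one-bit extensions died out, at levels \<open>k\<close> and
      \<open>l\<close>, no avoiding set through the node would be left at level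
      \<open>max k l\<close>.\<close>
    proof (rule ccontr)
      assume "\<not> ?thesis"
      moreover have "(Z - {m}) \<inter> {..<m} = Z \<inter> {..<m}" "insert m Z \<inter> {..<m} = Z \<inter> {..<m}"
        by auto
      ultimately have "\<not> ext (Suc m) (Z - {m})" "\<not> ext (Suc m) (insert m Z)"
        by blast+
      moreover have "\<exists>k. \<forall>Z'. Z' \<inter> {..<Suc m} = V \<inter> {..<Suc m} \<longrightarrow> W k Z'"
        if "\<not> ext (Suc m) V" for V
        using that by (simp add: ext_def)
      ultimately obtain k l where
        k: "\<forall>Z'. Z' \<inter> {..<Suc m} = (Z - {m}) \<inter> {..<Suc m} \<longrightarrow> W k Z'" and
        l: "\<forall>Z'. Z' \<inter> {..<Suc m} = insert m Z \<inter> {..<Suc m} \<longrightarrow> W l Z'"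
        by meson
      obtain Z' where Z': "Z' \<inter> {..<m} = Z \<inter> {..<m}" "\<not> W (max k l) Z'"
        using Z unfolding ext_def by blast
      have "Z' \<inter> {..<Suc m} = (if m \<in> Z' then insert m Z else Z - {m}) \<inter> {..<Suc m}"
        using Z'(1) by (auto simp: lessThan_Suc)
      then have "W k Z' \<or> W l Z'"
        using k l by (metis (full_types))
      then show False
        using Z'(2) extension_closedD[OF W _ max.cobounded1 refl]
          extension_closedD[OF W _ max.cobounded2 refl] by blast
    qed
  qed
  then obtain Zs where Zs: "\<And>m. ext m (Zs m)" "\<And>m. Zs (Suc m) \<inter> {..<m} = Zs m \<inter> {..<m}"
    by blast
  have eq: "Zs n \<inter> {..<m} = Zs m \<inter> {..<m}" if "m \<le> n" for m n
    using that
  proof (induction rule: dec_induct)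
    case (step n)
    have "Zs (Suc n) \<inter> {..<m} = (Zs (Suc n) \<inter> {..<n}) \<inter> {..<m}"
      using step.hyps by auto
    also have "\<dots> = (Zs n \<inter> {..<n}) \<inter> {..<m}"
      unfolding Zs(2) ..
    also have "\<dots> = Zs n \<inter> {..<m}"
      using step.hyps by auto
    finally show ?case
      using step.IH by (rule trans)
  qed simp
  \<comment> \<open>The segments cohere, so bit \<open>i\<close> is read off from the first one long
    enough to contain it.\<close>
  define Z where "Z = {i. i \<in> Zs (Suc i)}"
  have "i \<in> Z \<longleftrightarrow> i \<in> Zs m" if "i < m" for i m
    using eq[of "Suc i" m] that unfolding Z_def set_eq_iff Int_iff by auto
  then have Z: "Z \<inter> {..<m} = Zs m \<inter> {..<m}" for m
    by blast
  have "\<not> W m Z" for m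
  proof
    assume "W m Z"
    obtain Z' where "Z' \<inter> {..<m} = Zs m \<inter> {..<m}" "\<not> W m Z'"
      using Zs(1)[of m] unfolding ext_def by auto
    with \<open>W m Z\<close> show False
      using extension_closedD[OF W _ order_refl] Z by metis
  qed
  then show ?thesis by blast
qed

text \<open>\<open>W m\<close> sees only the first \<open>m\<close> bits, and these have codes below
  \<open>2 ^ m\<close>. A quantifier over sets thus becomes a bounded quantifier over
  numbers.\<close>

lemma all_sets_iff_all_codes:
  assumes "extension_closed W"
  shows "(\<forall>Z. W m Z) \<longleftrightarrow> (\<forall>w<2 ^ m. W m (set_decode w))"
proof (intro iffI allI)
  fix Z assume W: "\<forall>w<2 ^ m. W m (set_decode w)"
  have "set_encode (Z \<inter> {..<m}) \<le> set_encode {..<m}"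
    unfolding set_encode_def by (intro sum_mono2) auto
  also have "\<dots> < 2 ^ m"
    by (induction m) (auto simp: set_encode_def lessThan_Suc)
  finally have "W m (Z \<inter> {..<m})"
    using W by (metis finite_Int finite_lessThan set_encode_inverse)
  then show "W m Z"
    by (rule extension_closedD[OF assms]) auto
qed blast

lemma semidecidable_in_covered:
  assumes "\<And>n. extension_closed (W n)"
    and "semidecidable_in X (\<lambda>e. W (pfst e) (pfst (psnd e)) (set_decode (psnd (psnd e))))"
  shows "semidecidable_in X (\<lambda>n. \<exists>m. \<forall>Z. W n m Z)"
proof -
  \<comment> \<open>Reorders the environment: under both quantifiers the code comes first, then the
    level, then \<open>n\<close>.\<close>
  let ?f = "\<lambda>e. pair (psnd (psnd e)) (pair (pfst (psnd e)) (pfst e))"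
  have "recursive_in X ?f"
    by (intro recursive_intros)
  from semidecidable_in_comp[OF assms(2) this]
  have "semidecidable_in X (\<lambda>e. W (psnd (psnd e)) (pfst (psnd e)) (set_decode (pfst e)))"
    by simp
  then show ?thesis
    unfolding all_sets_iff_all_codes[OF assms(1)]
    by (intro semidecidable_in_ex semidecidable_in_all_less recursive_intros)
qed

text \<open>\<open>V n k\<close> covers the space exactly for the right value \<open>k\<close>, and
  covering is semidecidable, hence so is the graph of \<open>D\<close>.\<close>

lemma turing_reducible_if_covered:
  assumes "\<And>n k. extension_closed (V n k)"
    and "semidecidable_in X (\<lambda>e. V (pfst (pfst e)) (psnd (pfst e)) (pfst (psnd e))
           (set_decode (psnd (psnd e))))"
    and "\<And>n. \<exists>m. \<forall>Z. V n (of_bool (n \<in> D)) m Z"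
    and "\<And>n k m. k \<noteq> of_bool (n \<in> D) \<Longrightarrow> \<exists>Z. \<not> V n k m Z"
  shows "D \<le>\<^sub>T X"
proof (rule turing_reducible_if_semidecidable_graph)
  show "semidecidable_in X (\<lambda>e. \<exists>m. \<forall>Z. V (pfst e) (psnd e) m Z)"
    using assms(1,2) by (rule semidecidable_in_covered)
qed (use assms(3,4) in metis)

text \<open>
  If the added condition exhausted the whole space for every \<open>n\<close>, then \<open>D n\<close> would be the unique
  value on which all paths avoiding \<open>W\<close> agree, and compactness would make its graph semidecidable.
\<close>

lemma cone_avoidance_step:
  assumes D: "\<not> D \<le>\<^sub>T X" and W: "extension_closed W"
    "semidecidable_in X (\<lambda>e. W (pfst e) (set_decode (psnd e)))" "\<And>m. \<exists>Z. \<not> W m Z"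
  shows "\<exists>n. \<forall>m. \<exists>Z. \<not> (W m Z \<or> eval (restrict_oracle m Z) p [n] (of_bool (n \<in> D)))"
proof (rule ccontr)
  let ?V = "\<lambda>n k m Z. W m Z \<or> eval (restrict_oracle m Z) p [n] k"
  assume "\<not> ?thesis"
  then have cov: "\<exists>m. \<forall>Z. ?V n (of_bool (n \<in> D)) m Z" for n
    by blast
  have "D \<le>\<^sub>T X"
  proof (rule turing_reducible_if_covered[where V = ?V])
    show "extension_closed (?V n k)" for n k
      by (intro extension_closed_disj W(1) extension_closed_eval)
    show "semidecidable_in X (\<lambda>e. ?V (pfst (pfst e)) (psnd (pfst e)) (pfst (psnd e))
        (set_decode (psnd (psnd e))))"
      by (intro semidecidable_in_disj semidecidable_in_eval_singleton recursive_intros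
          semidecidable_in_comp[OF W(2)])
    fix n k l :: nat assume k: "k \<noteq> of_bool (n \<in> D)"
    show "\<exists>Z. \<not> ?V n k l Z"
    proof (rule ccontr)
      assume "\<not> ?thesis"
      then have k': "?V n k l Z" for Z by blast
      obtain m where m: "\<And>Z. ?V n (of_bool (n \<in> D)) m Z"
        using cov by blast
      \<comment> \<open>On a set that avoids \<open>W\<close> at both levels the program would
        output two different values.\<close>
      obtain Z where Z: "\<not> W (max m l) Z"
        using W(3) by blast
      then have "\<not> W m Z" "\<not> W l Z"
        using extension_closedD[OF W(1) _ max.cobounded1 refl]
          extension_closedD[OF W(1) _ max.cobounded2 refl] by blast+
      then have "computes Z p [n] (of_bool (n \<in> D))" "computes Z p [n] k"
        using m[of Z] k'[of Z] computes_if_eval_restrict_oracle[OF _ refl] by blast+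
      with k show False
        using computes_deterministic by blast
    qed
  qed (rule cov)
  with D show False by blast
qed

text \<open>Provides the enumeration \<open>from_nat\<close> of all programs along which
  requirements are met.\<close>

instance code :: countable
  by countable_datatype

text \<open>The open set \<open>W\<close> is enlarged step by step without exhausting the space;
  step \<open>s\<close> adds all oracles with which program \<open>s\<close> gives the right answer
  at a suitable input. A set outside the union defeats every program.\<close>

theorem cone_avoidance:
  assumes D: "\<not> D \<le>\<^sub>T X" and W: "extension_closed W"
    "semidecidable_in X (\<lambda>e. W (pfst e) (set_decode (psnd e)))" "\<And>m. \<exists>Z. \<not> W m Z"
  shows "\<exists>Z. (\<forall>m. \<not> W m Z) \<and> \<not> D \<le>\<^sub>T Z"
proof -
  define P where "P V \<longleftrightarrow> extension_closed V \<and> (\<forall>m. \<exists>Z. \<not> V m Z) \<and>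
    semidecidable_in X (\<lambda>e. V (pfst e) (set_decode (psnd e)))" for V
  define Q where "Q s V V' \<longleftrightarrow> (\<forall>m Z. V m Z \<longrightarrow> V' m Z) \<and>
    (\<exists>n. \<forall>m Z. eval (restrict_oracle m Z) (from_nat s) [n] (of_bool (n \<in> D)) \<longrightarrow> V' m Z)"
    for s :: nat and V V' :: "nat \<Rightarrow> nat set \<Rightarrow> bool"
  have "\<exists>Ws. \<forall>s. (P (Ws s) \<and> (s = 0 \<longrightarrow> Ws s = W)) \<and> Q s (Ws s) (Ws (Suc s))"
  proof (rule dependent_nat_choice)
    show "\<exists>V. P V \<and> (0 = (0::nat) \<longrightarrow> V = W)"
      using W by (auto simp: P_def)
  next
    fix V and s :: nat assume "P V \<and> (s = 0 \<longrightarrow> V = W)"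
    then have V: "extension_closed V" "\<And>m. \<exists>Z. \<not> V m Z"
      "semidecidable_in X (\<lambda>e. V (pfst e) (set_decode (psnd e)))"
      by (auto simp: P_def)
    let ?E = "\<lambda>n m Z. eval (restrict_oracle m Z) (from_nat s) [n] (of_bool (n \<in> D))"
    obtain n where n: "\<And>m. \<exists>Z. \<not> (V m Z \<or> ?E n m Z)"
      using cone_avoidance_step[OF D V(1,3,2), where p = "from_nat s"] by blast
    have "extension_closed (\<lambda>m Z. V m Z \<or> ?E n m Z)"
      by (intro extension_closed_disj V(1) extension_closed_eval)
    moreover have "semidecidable_in X
        (\<lambda>e. V (pfst e) (set_decode (psnd e)) \<or> ?E n (pfst e) (set_decode (psnd e)))"
      by (intro semidecidable_in_disj V(3) semidecidable_in_eval_singleton recursive_intros)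
    ultimately have "P (\<lambda>m Z. V m Z \<or> ?E n m Z)"
      using n unfolding P_def by blast
    moreover have "Q s V (\<lambda>m Z. V m Z \<or> ?E n m Z)"
      unfolding Q_def by blast
    ultimately show "\<exists>V'. (P V' \<and> (Suc s = 0 \<longrightarrow> V' = W)) \<and> Q s V V'"
      by blast
  qed
  then obtain Ws where Ws: "\<And>s. P (Ws s)" "Ws 0 = W" "\<And>s. Q s (Ws s) (Ws (Suc s))"
    by blast
  have mono: "Ws s m Z \<Longrightarrow> s \<le> t \<Longrightarrow> Ws t m Z" for s t m Z
    using lift_Suc_mono_le[of "\<lambda>s. {(m, Z). Ws s m Z}" s t] Ws(3) unfolding Q_def by blast
  let ?W = "\<lambda>m Z. \<exists>s. Ws s m Z"
  have "extension_closed ?W"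
    using Ws(1) unfolding P_def extension_closed_def by blast
  \<comment> \<open>If the union covered the space at level \<open>m\<close>, a single step
    \<open>s\<close> would already cover the finitely many codes below \<open>2 ^ m\<close>.\<close>
  moreover have "\<exists>Z. \<not> ?W m Z" for m
  proof (rule ccontr)
    assume "\<not> ?thesis"
    then have "\<forall>w. \<exists>s. Ws s m (set_decode w)" by blast
    then have "\<exists>s. \<forall>w<2 ^ m. Ws s m (set_decode w)"
      by (intro ex_uniform_bound) (use mono in blast)+
    then obtain s where "\<forall>Z. Ws s m Z"
      using all_sets_iff_all_codes Ws(1) unfolding P_def by blast
    then show False
      using Ws(1) unfolding P_def by blast
  qed
  ultimately obtain Z where Z: "\<And>m s. \<not> Ws s m Z"
    using Koenig[of ?W] by blast
  have "\<not> D \<le>\<^sub>T Z"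
  proof
    assume "D \<le>\<^sub>T Z"
    then obtain p where p: "\<And>n. computes Z p [n] (of_bool (n \<in> D))"
      unfolding turing_reducible_def by blast
    obtain n where "\<And>m. eval (restrict_oracle m Z) p [n] (of_bool (n \<in> D)) \<Longrightarrow>
        Ws (Suc (to_nat p)) m Z"
      using Ws(3)[of "to_nat p"] unfolding Q_def from_nat_to_nat by blast
    then show False
      using Z eval_if_computes[OF p] by blast
  qed
  then show ?thesis
    using Z[of 0] Ws(2) by blast
qed

section \<open>Strong cone avoidance for the infinite pigeonhole principle\<close>

lemma not_turing_reducible_Diff_finite:
  assumes "\<not> D \<le>\<^sub>T X" "finite E" shows "\<not> D \<le>\<^sub>T X - E"
proof -
  have "decidable_in X (\<lambda>n. n \<in> X \<and> \<not> n \<in> E)"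
    by (intro decidable_in_conj decidable_in_not decidable_in_oracle decidable_in_finite
        recursive_in_id assms)
  then have "X - E \<le>\<^sub>T X"
    unfolding turing_reducible_iff by simp
  then show ?thesis
    using assms(1) turing_reducible_trans by blast
qed

text \<open>
  Some oracle between \<open>F\<close> and \<open>F \<union> S\<close> makes the program \<open>p\<close> output \<open>k\<close> on input \<open>n\<close>; only the
  initial segment coded by \<open>w\<close> is consulted.
\<close>

definition possible_output :: "nat set \<Rightarrow> nat set \<Rightarrow> code \<Rightarrow> nat \<Rightarrow> nat \<Rightarrow> bool" where
  "possible_output F S p n k \<longleftrightarrow> (\<exists>u w. eval (restrict_oracle u (set_decode w)) p [n] k \<and>
     (\<forall>x<u. (x \<in> F \<longrightarrow> x \<in> set_decode w) \<and> (x \<in> set_decode w \<longrightarrow> x \<in> F \<or> x \<in> S)))"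

lemma possible_output_mono:
  "possible_output F S p n k \<Longrightarrow> S \<subseteq> S' \<Longrightarrow> possible_output F S' p n k"
  unfolding possible_output_def by blast

lemma possible_output_finite:
  "possible_output F S p n k \<Longrightarrow> \<exists>m. possible_output F (S \<inter> {..<m}) p n k"
  unfolding possible_output_def by blast

lemma possible_output_if_computes:
  assumes "computes G p [n] k" "F \<subseteq> G" "G \<subseteq> F \<union> S"
  shows "possible_output F S p n k"
proof -
  obtain u where "eval (restrict_oracle u G) p [n] k"
    using eval_if_computes[OF assms(1)] by blast
  moreover have "set_decode (set_encode (G \<inter> {..<u})) = G \<inter> {..<u}"
    by (simp add: set_encode_inverse)
  moreover have "restrict_oracle u (G \<inter> {..<u}) = restrict_oracle u G"
    by (rule restrict_oracle_cong) auto
  ultimately show ?thesis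
    unfolding possible_output_def using assms(2,3)
    by (intro exI[of _ u] exI[of _ "set_encode (G \<inter> {..<u})"]) auto
qed

text \<open>The oracle elements below the use \<open>u\<close> are put into \<open>F'\<close>, and
  cutting the reservoir at \<open>u\<close> freezes the negative answers, so the computation is
  preserved.\<close>

lemma possible_output_forced:
  assumes "possible_output F S p n k" "finite F"
  obtains F' u where "finite F'" "F \<subseteq> F'" "F' \<subseteq> F \<union> S"
    "\<And>X G. F' \<subseteq> G \<Longrightarrow> G \<subseteq> F' \<union> (X - {..<u}) \<Longrightarrow> computes G p [n] k"
proof -
  obtain u w where w: "eval (restrict_oracle u (set_decode w)) p [n] k"
    "\<And>x. x < u \<Longrightarrow> x \<in> F \<Longrightarrow> x \<in> set_decode w"
    "\<And>x. x < u \<Longrightarrow> x \<in> set_decode w \<Longrightarrow> x \<in> F \<or> x \<in> S"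
    using assms(1) unfolding possible_output_def by blast
  show ?thesis
  proof (rule that[of "F \<union> (set_decode w \<inter> {..<u})" u])
    fix X G
    assume "F \<union> (set_decode w \<inter> {..<u}) \<subseteq> G" "G \<subseteq> F \<union> (set_decode w \<inter> {..<u}) \<union> (X - {..<u})"
    with w(2) have "set_decode w \<inter> {..<u} = G \<inter> {..<u}" by blast
    with w(1) show "computes G p [n] k"
      by (rule computes_if_eval_restrict_oracle)
  qed (use w(3) assms(2) in auto)
qed

text \<open>With \<open>(F, X)\<close> read as a Mathias condition, this is the forcing of the
  requirement that \<open>p\<close> does not reduce \<open>D\<close> to the generic set.\<close>

definition not_reduction_between :: "nat set \<Rightarrow> code \<Rightarrow> nat set \<Rightarrow> nat set \<Rightarrow> bool" where
  "not_reduction_between D p F X \<longleftrightarrow>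
     (\<forall>G. F \<subseteq> G \<longrightarrow> G \<subseteq> F \<union> X \<longrightarrow> (\<exists>n. \<not> computes G p [n] (of_bool (n \<in> D))))"

lemma not_reduction_between_mono:
  assumes "not_reduction_between D p F X" "F \<subseteq> F'" "F' \<union> X' \<subseteq> F \<union> X"
  shows "not_reduction_between D p F' X'"
  unfolding not_reduction_between_def
proof (intro allI impI)
  fix G assume "F' \<subseteq> G" "G \<subseteq> F' \<union> X'"
  with assms(2,3) have "F \<subseteq> G" "G \<subseteq> F \<union> X"
    by (blast dest: subset_trans)+
  with assms(1) show "\<exists>n. \<not> computes G p [n] (of_bool (n \<in> D))"
    unfolding not_reduction_between_def by blast
qed

lemma not_reduction_between_if_not_possible:
  "\<not> possible_output F X p n (of_bool (n \<in> D)) \<Longrightarrow> not_reduction_between D p F X"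
  unfolding not_reduction_between_def using possible_output_if_computes by blast

lemma not_reduction_between_if_wrong:
  assumes "possible_output F S p n k" "finite F" "k \<noteq> of_bool (n \<in> D)"
  obtains F' u where "finite F'" "F \<subseteq> F'" "F' \<subseteq> F \<union> S"
    "\<And>X. not_reduction_between D p F' (X - {..<u})"
proof -
  obtain F' u where F': "finite F'" "F \<subseteq> F'" "F' \<subseteq> F \<union> S"
    "\<And>X G. F' \<subseteq> G \<Longrightarrow> G \<subseteq> F' \<union> (X - {..<u}) \<Longrightarrow> computes G p [n] k"
    using possible_output_forced[OF assms(1,2)] by blast
  have "not_reduction_between D p F' (X - {..<u})" for X
    unfolding not_reduction_between_def
  proof (intro allI impI exI notI)
    fix G assume "F' \<subseteq> G" "G \<subseteq> F' \<union> (X - {..<u})"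
    then have "computes G p [n] k" by (rule F'(4))
    moreover assume "computes G p [n] (of_bool (n \<in> D))"
    ultimately show False
      using assms(3) computes_deterministic by blast
  qed
  with F'(1-3) show ?thesis
    by (rule that)
qed

text \<open>As \<open>A\<close> is arbitrary, all partitions of \<open>X\<close> are treated at
  once. Either some wrong value is possible under all of them, in particular under \<open>A\<close>;
  or for some \<open>n\<close> the right value is avoided by a partition, and cone avoidance
  provides one with an infinite side that can become the reservoir; or \<open>D\<close> would be
  reducible to \<open>X\<close>.\<close>

lemma force_not_reduction:
  assumes fin: "finite F" "finite F'" and X: "infinite X" "\<not> D \<le>\<^sub>T X"
  shows "\<exists>E E' Y. finite E \<and> finite E' \<and> F \<subseteq> E \<and> E \<subseteq> F \<union> (X \<inter> A) \<and> F' \<subseteq> E' \<and>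
    E' \<subseteq> F' \<union> (X - A) \<and> Y \<subseteq> X \<and> infinite Y \<and> \<not> D \<le>\<^sub>T Y \<and>
    (not_reduction_between D p E Y \<or> not_reduction_between D q E' Y)"
proof -
  \<comment> \<open>The first disjunct restricts attention to partitions \<open>(Z, X - Z)\<close> of \<open>X\<close>. No join \<open>Z \<oplus> X\<close> is
    needed: either \<open>Z\<close> is infinite, or \<open>X - Z\<close> differs only finitely from \<open>X\<close>.\<close>
  define V where "V n k m Z \<longleftrightarrow> (\<exists>x<m. x \<in> Z \<and> x \<notin> X) \<or>
    possible_output F {x. x < m \<and> x \<in> Z \<and> x \<in> X} p n k \<or>
    possible_output F' {x. x < m \<and> x \<notin> Z \<and> x \<in> X} q n k" for n k m Z
  have V_ext: "extension_closed (V n k)" for n k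
    unfolding extension_closed_def
  proof (intro allI impI)
    fix m m' Z Z' assume *: "V n k m Z" "m \<le> m'" "Z \<inter> {..<m} = Z' \<inter> {..<m}"
    have iff: "x \<in> Z \<longleftrightarrow> x \<in> Z'" if "x < m" for x
      using *(3) that by blast
    have "{x. x < m \<and> x \<in> Z \<and> x \<in> X} \<subseteq> {x. x < m' \<and> x \<in> Z' \<and> x \<in> X}"
      "{x. x < m \<and> x \<notin> Z \<and> x \<in> X} \<subseteq> {x. x < m' \<and> x \<notin> Z' \<and> x \<in> X}"
      using iff *(2) by auto
    then show "V n k m' Z'"
      using *(1,2) iff unfolding V_def by (meson possible_output_mono order_less_le_trans)
  qed
  have V_semi: "semidecidable_in X (\<lambda>e. V (pfst (pfst e)) (psnd (pfst e)) (pfst (psnd e))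
      (set_decode (psnd (psnd e))))"
    unfolding V_def possible_output_def mem_Collect_eq
    by (intro semidecidable_in_disj semidecidable_in_ex semidecidable_in_conj
        semidecidable_in_decidable[OF decidable_in_ex_less]
        semidecidable_in_decidable[OF decidable_in_all_less]
        semidecidable_in_eval_singleton decidable_in_conj decidable_in_not decidable_in_imp
        decidable_in_disj decidable_in_less decidable_in_oracle decidable_in_set_decode
        decidable_in_finite fin recursive_intros)
  consider (wrong) n k m where "k \<noteq> of_bool (n \<in> D)" "\<forall>Z. V n k m Z"
    | (not_covered) n where "\<And>m. \<exists>Z. \<not> V n (of_bool (n \<in> D)) m Z"
    | (graph) "\<And>n. \<exists>m. \<forall>Z. V n (of_bool (n \<in> D)) m Z"
        "\<And>n k m. k \<noteq> of_bool (n \<in> D) \<Longrightarrow> \<exists>Z. \<not> V n k m Z"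
    by blast
  then show ?thesis
  proof cases
    case wrong
    \<comment> \<open>Intersecting with \<open>X\<close> excludes the first disjunct of
      \<open>V\<close>, so the wrong value is possible on one side of \<open>A\<close>.\<close>
    then have "V n k m (A \<inter> X)" by blast
    moreover have "{x. x < m \<and> x \<in> A \<inter> X \<and> x \<in> X} \<subseteq> X \<inter> A"
      "{x. x < m \<and> x \<notin> A \<inter> X \<and> x \<in> X} \<subseteq> X - A"
      by auto
    ultimately have "possible_output F (X \<inter> A) p n k \<or> possible_output F' (X - A) q n k"
      unfolding V_def using possible_output_mono by blast
    then show ?thesis
    proof
      assume "possible_output F (X \<inter> A) p n k"
      from not_reduction_between_if_wrong[OF this fin(1) wrong(1)] obtain E u where
        "finite E" "F \<subseteq> E" "E \<subseteq> F \<union> (X \<inter> A)" "\<And>X. not_reduction_between D p E (X - {..<u})"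
        by blast
      then show ?thesis
        using fin(2) X not_turing_reducible_Diff_finite[OF X(2), of "{..<u}"]
        by (intro exI[of _ E] exI[of _ F'] exI[of _ "X - {..<u}"]) auto
    next
      assume "possible_output F' (X - A) q n k"
      from not_reduction_between_if_wrong[OF this fin(2) wrong(1)] obtain E u where
        "finite E" "F' \<subseteq> E" "E \<subseteq> F' \<union> (X - A)" "\<And>X. not_reduction_between D q E (X - {..<u})"
        by blast
      then show ?thesis
        using fin(1) X not_turing_reducible_Diff_finite[OF X(2), of "{..<u}"]
        by (intro exI[of _ F] exI[of _ E] exI[of _ "X - {..<u}"]) auto
    qed
  next
    case not_covered
    have "semidecidable_in X (\<lambda>e. V n (of_bool (n \<in> D)) (pfst e) (set_decode (psnd e)))"
      using semidecidable_in_comp[OF V_semi recursive_in_pair[OF recursive_in_const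
            [of _ "pair n (of_bool (n \<in> D))"] recursive_in_id]]
      by simp
    from cone_avoidance[OF X(2) V_ext this not_covered]
    obtain Z where Z: "\<And>m. \<not> V n (of_bool (n \<in> D)) m Z" "\<not> D \<le>\<^sub>T Z" by blast
    have sub: "Z \<subseteq> X"
      using Z(1) unfolding V_def by blast
    have "\<not> possible_output F Z p n (of_bool (n \<in> D))"
    proof
      assume "possible_output F Z p n (of_bool (n \<in> D))"
      from possible_output_finite[OF this] obtain m where
        "possible_output F (Z \<inter> {..<m}) p n (of_bool (n \<in> D))" by blast
      then have "possible_output F {x. x < m \<and> x \<in> Z \<and> x \<in> X} p n (of_bool (n \<in> D))"
        by (rule possible_output_mono) (use sub in auto)
      then have "V n (of_bool (n \<in> D)) m Z"
        unfolding V_def by blast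
      with Z(1) show False by blast
    qed
    moreover have "\<not> possible_output F' (X - Z) q n (of_bool (n \<in> D))"
    proof
      assume "possible_output F' (X - Z) q n (of_bool (n \<in> D))"
      from possible_output_finite[OF this] obtain m where
        "possible_output F' ((X - Z) \<inter> {..<m}) q n (of_bool (n \<in> D))" by blast
      then have "possible_output F' {x. x < m \<and> x \<notin> Z \<and> x \<in> X} q n (of_bool (n \<in> D))"
        by (rule possible_output_mono) auto
      then have "V n (of_bool (n \<in> D)) m Z"
        unfolding V_def by blast
      with Z(1) show False by blast
    qed
    ultimately have no: "not_reduction_between D p F Z" "not_reduction_between D q F' (X - Z)"
      by (blast intro: not_reduction_between_if_not_possible)+
    show ?thesis
    proof (cases "finite Z")
      case True
      with no fin X not_turing_reducible_Diff_finite[OF X(2) True] show ?thesis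
        by (intro exI[of _ F] exI[of _ F'] exI[of _ "X - Z"]) auto
    next
      case False
      with no fin Z(2) sub show ?thesis
        by (intro exI[of _ F] exI[of _ F'] exI[of _ Z]) auto
    qed
  next
    case graph
    have "D \<le>\<^sub>T X"
      using V_ext V_semi graph by (rule turing_reducible_if_covered)
    with X(2) show ?thesis by blast
  qed
qed

text \<open>
  The case \<open>A = B = UNIV\<close> is ordinary Mathias forcing; \<open>B = - A\<close> gives strong cone avoidance.
\<close>

lemma ex_generic_pigeonhole_set:
  fixes R :: "nat \<Rightarrow> nat set \<Rightarrow> bool"
  assumes Y: "infinite Y" "\<not> D \<le>\<^sub>T Y" and cover: "A \<union> B = UNIV"
    and split: "\<And>X. X \<subseteq> Y \<Longrightarrow> infinite X \<Longrightarrow> \<not> D \<le>\<^sub>T X \<Longrightarrow> infinite (X \<inter> A) \<and> infinite (X \<inter> B)"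
    and hereditary: "\<And>i X X'. R i X \<Longrightarrow> X' \<subseteq> X \<Longrightarrow> R i X'"
    and dense: "\<And>i X. infinite X \<Longrightarrow> \<not> D \<le>\<^sub>T X \<Longrightarrow>
      \<exists>X'\<subseteq>X. infinite X' \<and> \<not> D \<le>\<^sub>T X' \<and> R i X'"
  shows "\<exists>H. infinite H \<and> (H \<subseteq> Y \<inter> A \<or> H \<subseteq> Y \<inter> B) \<and> \<not> D \<le>\<^sub>T H \<and>
    (\<forall>i. \<exists>E. finite E \<and> R i (H - E))"
proof -
  \<comment> \<open>Conditions have two finite parts, one inside \<open>A\<close> and one inside
    \<open>B\<close>, over a common reservoir.\<close>
  define P where "P = (\<lambda>(F, F', X). finite F \<and> finite F' \<and> F \<subseteq> Y \<inter> A \<and> F' \<subseteq> Y \<inter> B \<and>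
    X \<subseteq> Y \<and> infinite X \<and> \<not> D \<le>\<^sub>T X)"
  \<comment> \<open>Stage \<open>s\<close> handles \<open>R s\<close> and the pair of programs coded
    by \<open>s\<close>, at least one of which is made to fail; strict growth makes both limits
    infinite.\<close>
  define Q where "Q = (\<lambda>s (F, F', X) (E, E', Z). F \<subset> E \<and> E \<subseteq> F \<union> X \<and> F' \<subset> E' \<and> E' \<subseteq> F' \<union> X \<and>
    Z \<subseteq> X \<and> R s Z \<and> (not_reduction_between D (from_nat (pfst s)) E Z \<or>
      not_reduction_between D (from_nat (psnd s)) E' Z))"
  have "\<exists>c. \<forall>s. P (c s) \<and> Q s (c s) (c (Suc s))"
  proof (rule dependent_nat_choice)
    show "\<exists>c. P c"
      using Y by (intro exI[of _ "({}, {}, Y)"]) (simp add: P_def)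
  next
    fix c s assume "P c"
    obtain F F' X where c: "c = (F, F', X)" by (cases c)
    then have X: "finite F" "finite F'" "F \<subseteq> Y \<inter> A" "F' \<subseteq> Y \<inter> B" "X \<subseteq> Y" "infinite X" "\<not> D \<le>\<^sub>T X"
      using \<open>P c\<close> by (auto simp: P_def)
    obtain E E' Z where Z: "finite E" "finite E'" "F \<subseteq> E" "E \<subseteq> F \<union> (X \<inter> A)" "F' \<subseteq> E'"
      "E' \<subseteq> F' \<union> (X - A)" "Z \<subseteq> X" "infinite Z" "\<not> D \<le>\<^sub>T Z"
      and no: "not_reduction_between D (from_nat (pfst s)) E Z \<or>
        not_reduction_between D (from_nat (psnd s)) E' Z"
      using force_not_reduction[OF X(1,2,6,7), of A "from_nat (pfst s)" "from_nat (psnd s)"] by blast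
    \<comment> \<open>Forcing need not add elements; \<open>split\<close> supplies a fresh one for
      each side.\<close>
    have "infinite (Z \<inter> A - E)" "infinite (Z \<inter> B - E')"
      using split[of Z] Z X(5) by auto
    then have "Z \<inter> A - E \<noteq> {}" "Z \<inter> B - E' \<noteq> {}"
      by (blast dest: infinite_imp_nonempty)+
    then obtain x x' where x: "x \<in> Z \<inter> A - E" "x' \<in> Z \<inter> B - E'"
      by blast
    obtain Z' where Z': "Z' \<subseteq> Z" "infinite Z'" "\<not> D \<le>\<^sub>T Z'" "R s Z'"
      using dense[OF Z(8,9)] by blast
    have "not_reduction_between D (from_nat (pfst s)) (insert x E) Z' \<or>
        not_reduction_between D (from_nat (psnd s)) (insert x' E') Z'"
      using no
    proof
      assume "not_reduction_between D (from_nat (pfst s)) E Z"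
      then show ?thesis
        by (intro disjI1, rule not_reduction_between_mono) (use x Z'(1) in auto)
    next
      assume "not_reduction_between D (from_nat (psnd s)) E' Z"
      then show ?thesis
        by (intro disjI2, rule not_reduction_between_mono) (use x Z'(1) in auto)
    qed
    moreover have "insert x E \<subseteq> F \<union> X" "insert x' E' \<subseteq> F' \<union> X"
      using x Z by auto
    moreover have "F \<subset> insert x E" "F' \<subset> insert x' E'"
      using x Z(3,5) by auto
    \<comment> \<open>\<open>A\<close> and \<open>B\<close> may overlap: forcing works with
      \<open>A\<close> and its complement, which \<open>cover\<close> puts inside
      \<open>B\<close>.\<close>
    moreover have "X - A \<subseteq> B"
      using cover by auto
    then have "insert x E \<subseteq> Y \<inter> A" "insert x' E' \<subseteq> Y \<inter> B"
      using x Z(4,6,7) X(3-5) by auto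
    ultimately show "\<exists>c'. P c' \<and> Q s c c'"
      using Z Z' X(5) unfolding c P_def Q_def
      by (intro exI[of _ "(insert x E, insert x' E', Z')"]) auto
  qed
  then obtain c where c: "\<And>s. P (c s)" "\<And>s. Q s (c s) (c (Suc s))"
    by blast
  define F where "F s = fst (c s)" for s
  define F' where "F' s = fst (snd (c s))" for s
  define X where "X s = snd (snd (c s))" for s
  have c_eq: "c s = (F s, F' s, X s)" for s
    by (simp add: F_def F'_def X_def)
  have P: "F s \<subseteq> Y \<inter> A" "F' s \<subseteq> Y \<inter> B" "finite (F s)" "finite (F' s)" for s
    using c(1)[of s] unfolding c_eq P_def by auto
  have Q: "F s \<subset> F (Suc s)" "F (Suc s) \<subseteq> F s \<union> X s" "F' s \<subset> F' (Suc s)" "F' (Suc s) \<subseteq> F' s \<union> X s"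
    "X (Suc s) \<subseteq> X s" "R s (X (Suc s))"
    "not_reduction_between D (from_nat (pfst s)) (F (Suc s)) (X (Suc s)) \<or>
      not_reduction_between D (from_nat (psnd s)) (F' (Suc s)) (X (Suc s))" for s
    using c(2)[of s] unfolding c_eq Q_def by auto
  have limit: "infinite (\<Union>t. G t)" "G s \<subseteq> (\<Union>t. G t)" "(\<Union>t. G t) \<subseteq> G s \<union> X s"
    if G: "\<And>t. G t \<subset> G (Suc t)" "\<And>t. G (Suc t) \<subseteq> G t \<union> X t" for G s
  proof -
    have mono: "t \<le> t' \<Longrightarrow> G t \<subseteq> G t'" for t t'
      by (rule lift_Suc_mono_le[of G]) (use G(1) in auto)
    have anti: "t \<le> t' \<Longrightarrow> G t' \<union> X t' \<subseteq> G t \<union> X t" for t t'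
      by (rule lift_Suc_antimono_le[of "\<lambda>t. G t \<union> X t"]) (use G(2) Q(5) in blast)+
    show "G s \<subseteq> (\<Union>t. G t)" by blast
    show "(\<Union>t. G t) \<subseteq> G s \<union> X s"
    proof (intro UN_least)
      fix t show "G t \<subseteq> G s \<union> X s"
        using mono[of t s] anti[of s t] by (cases "t \<le> s") auto
    qed
    show "infinite (\<Union>t. G t)"
    proof
      assume fin: "finite (\<Union>t. G t)"
      have "t \<le> card (G t)" for t
      proof (induction t)
        case (Suc t)
        have "finite (G (Suc t))"
          using fin by (rule finite_subset[rotated]) blast
        from psubset_card_mono[OF this G(1)] Suc show ?case by simp
      qed simp
      moreover have "card (G t) \<le> card (\<Union>t. G t)" for t
        using fin by (intro card_mono) blast+
      ultimately show False
        by (meson not_less_eq_eq order_trans)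
    qed
  qed
  have F: "infinite (\<Union>t. F t)" "F s \<subseteq> (\<Union>t. F t)" "(\<Union>t. F t) \<subseteq> F s \<union> X s" for s
    using limit[of F, OF Q(1,2)] by blast+
  have F': "infinite (\<Union>t. F' t)" "F' s \<subseteq> (\<Union>t. F' t)" "(\<Union>t. F' t) \<subseteq> F' s \<union> X s" for s
    using limit[of F', OF Q(3,4)] by blast+
  \<comment> \<open>Removing the finite part of stage \<open>Suc i\<close> leaves a subset of the
    reservoir \<open>X (Suc i)\<close>, where \<open>R i\<close> holds.\<close>
  have reqs: "\<exists>E. finite E \<and> R i (H - E)" if "\<And>s. finite (G s)" "\<And>s. H \<subseteq> G s \<union> X s" for G H i
  proof (intro exI conjI)
    show "R i (H - G (Suc i))"
      using Q(6) by (rule hereditary) (use that(2) in blast)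
  qed (rule that(1))
  \<comment> \<open>Reductions \<open>p\<close> and \<open>q\<close> from the two limits would
    contradict the stage coded by their pair.\<close>
  have "\<not> D \<le>\<^sub>T (\<Union>t. F t) \<or> \<not> D \<le>\<^sub>T (\<Union>t. F' t)"
  proof (rule ccontr)
    assume "\<not> ?thesis"
    then obtain p q where p: "\<And>n. computes (\<Union>t. F t) p [n] (of_bool (n \<in> D))"
      and q: "\<And>n. computes (\<Union>t. F' t) q [n] (of_bool (n \<in> D))"
      unfolding turing_reducible_def by blast
    let ?s = "pair (to_nat p) (to_nat q)"
    have "not_reduction_between D p (F (Suc ?s)) (X (Suc ?s)) \<or>
        not_reduction_between D q (F' (Suc ?s)) (X (Suc ?s))"
      using Q(7)[of ?s] by simp
    then show False
      using p q F(2,3)[of "Suc ?s"] F'(2,3)[of "Suc ?s"] unfolding not_reduction_between_def by blast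
  qed
  then show ?thesis
  proof
    assume "\<not> D \<le>\<^sub>T (\<Union>t. F t)"
    then show ?thesis
      using F(1) P(1) reqs[of F, OF P(3) F(3)] by (intro exI[of _ "\<Union>t. F t"]) blast
  next
    assume "\<not> D \<le>\<^sub>T (\<Union>t. F' t)"
    then show ?thesis
      using F'(1) P(2) reqs[of F', OF P(4) F'(3)] by (intro exI[of _ "\<Union>t. F' t"]) blast
  qed
qed

lemma ex_generic_set:
  fixes R :: "nat \<Rightarrow> nat set \<Rightarrow> bool"
  assumes "infinite Y" "\<not> D \<le>\<^sub>T Y" "\<And>i X X'. R i X \<Longrightarrow> X' \<subseteq> X \<Longrightarrow> R i X'"
    "\<And>i X. infinite X \<Longrightarrow> \<not> D \<le>\<^sub>T X \<Longrightarrow> \<exists>X'\<subseteq>X. infinite X' \<and> \<not> D \<le>\<^sub>T X' \<and> R i X'"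
  shows "\<exists>H\<subseteq>Y. infinite H \<and> \<not> D \<le>\<^sub>T H \<and> (\<forall>i. \<exists>E. finite E \<and> R i (H - E))"
proof -
  have "\<exists>H. infinite H \<and> (H \<subseteq> Y \<inter> UNIV \<or> H \<subseteq> Y \<inter> UNIV) \<and> \<not> D \<le>\<^sub>T H \<and>
      (\<forall>i. \<exists>E. finite E \<and> R i (H - E))"
    by (rule ex_generic_pigeonhole_set[OF assms(1,2) _ _ assms(3,4)]) auto
  then show ?thesis
    by auto
qed

text \<open>If some reservoir meets \<open>A\<close> or its complement in a finite set, deleting
  that set suffices; otherwise the hypothesis \<open>split\<close> of the generic construction
  holds.\<close>

theorem strong_cone_avoidance:
  assumes "infinite Y" "\<not> D \<le>\<^sub>T Y"
  shows "\<exists>H\<subseteq>Y. infinite H \<and> \<not> D \<le>\<^sub>T H \<and> (H \<subseteq> A \<or> H \<inter> A = {})"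
proof (cases "\<forall>X\<subseteq>Y. infinite X \<longrightarrow> \<not> D \<le>\<^sub>T X \<longrightarrow> infinite (X \<inter> A) \<and> infinite (X \<inter> - A)")
  case True
  \<comment> \<open>There are no side requirements here: the family \<open>R\<close> is constantly
    true.\<close>
  have "\<exists>H. infinite H \<and> (H \<subseteq> Y \<inter> A \<or> H \<subseteq> Y \<inter> - A) \<and> \<not> D \<le>\<^sub>T H \<and>
      (\<forall>i::nat. \<exists>E::nat set. finite E \<and> True)"
    by (rule ex_generic_pigeonhole_set[OF assms]) (use True in blast)+
  then show ?thesis
    by blast
next
  case False
  then obtain X where X: "X \<subseteq> Y" "infinite X" "\<not> D \<le>\<^sub>T X" "finite (X \<inter> A) \<or> finite (X \<inter> - A)"
    by blast
  from X(4) show ?thesis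
  proof
    assume "finite (X \<inter> A)"
    with X show ?thesis
      using not_turing_reducible_Diff_finite[of D X "X \<inter> A"] by (intro exI[of _ "X - X \<inter> A"]) auto
  next
    assume "finite (X \<inter> - A)"
    with X show ?thesis
      using not_turing_reducible_Diff_finite[of D X "X \<inter> - A"] by (intro exI[of _ "X - X \<inter> - A"]) auto
  qed
qed

section \<open>Seetapun's theorem\<close>

text \<open>One pass in increasing order: each decision depends only on earlier ones, so the result
  is recursive in \<open>H\<close> if \<open>c\<close> is.\<close>

fun greedy :: "(nat \<Rightarrow> nat \<Rightarrow> bool) \<Rightarrow> nat set \<Rightarrow> nat \<Rightarrow> bool" where
  "greedy c H y \<longleftrightarrow> y \<in> H \<and> (\<forall>x<y. greedy c H x \<longrightarrow> c x y)"

declare greedy.simps [simp del]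

lemma greedyD:
  assumes "greedy c H y"
  shows "y \<in> H" "x < y \<Longrightarrow> greedy c H x \<Longrightarrow> c x y"
  using assms by (subst (asm) greedy.simps, blast)+

text \<open>Course-of-values recursion is replaced by a search: \<open>ok w x\<close> checks the
  recursion equation for the code \<open>w\<close> up to \<open>x\<close>. This determines the
  initial segment, so any such \<open>w\<close> decides \<open>x\<close>.\<close>

lemma turing_reducible_greedy:
  assumes c: "decidable_in H (\<lambda>e. c (pfst e) (psnd e))"
  shows "{y. greedy c H y} \<le>\<^sub>T H"
proof -
  define ok where "ok w x \<longleftrightarrow> (\<forall>y<Suc x. y \<in> set_decode w \<longleftrightarrow>
    y \<in> H \<and> (\<forall>z<y. z \<in> set_decode w \<longrightarrow> c z y))" for w x
  have ok: "y \<in> set_decode w \<longleftrightarrow> greedy c H y" if "ok w x" "y \<le> x" for w x y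
    using that(2)
  proof (induction y rule: less_induct)
    case (less y)
    have "y \<in> set_decode w \<longleftrightarrow> y \<in> H \<and> (\<forall>z<y. z \<in> set_decode w \<longrightarrow> c z y)"
      using that(1) less.prems unfolding ok_def by (meson le_imp_less_Suc)
    also have "\<dots> \<longleftrightarrow> y \<in> H \<and> (\<forall>z<y. greedy c H z \<longrightarrow> c z y)"
      using less by (metis less_imp_le_nat order_trans)
    also have "\<dots> \<longleftrightarrow> greedy c H y"
      by (rule greedy.simps[symmetric])
    finally show ?case .
  qed
  have "\<exists>w. ok w x" for x
  proof -
    have w: "set_decode (set_encode {y. y \<le> x \<and> greedy c H y}) = {y. y \<le> x \<and> greedy c H y}"
      by (rule set_encode_inverse) simp
    show ?thesis
      unfolding ok_def
    proof (intro exI[of _ "set_encode {y. y \<le> x \<and> greedy c H y}"] allI impI)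
      fix y assume "y < Suc x"
      then show "y \<in> set_decode (set_encode {y. y \<le> x \<and> greedy c H y}) \<longleftrightarrow> y \<in> H \<and>
          (\<forall>z<y. z \<in> set_decode (set_encode {y. y \<le> x \<and> greedy c H y}) \<longrightarrow> c z y)"
        unfolding w mem_Collect_eq by (subst greedy.simps) auto
    qed
  qed
  moreover have "(\<exists>w. ok w x \<and> k = of_bool (x \<in> set_decode w)) \<longleftrightarrow>
      k = of_bool (x \<in> {y. greedy c H y})" if "\<exists>w. ok w x" for x and k :: nat
    using that ok[OF _ order_refl] by force
  ultimately have graph: "(\<exists>w. ok w x \<and> k = of_bool (x \<in> set_decode w)) \<longleftrightarrow>
      k = of_bool (x \<in> {y. greedy c H y})" for x and k :: nat
    by blast
  show ?thesis
  proof (rule turing_reducible_if_semidecidable_graph[OF _ graph])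
    show "semidecidable_in H (\<lambda>e. \<exists>w. ok w (pfst e) \<and> psnd e = of_bool (pfst e \<in> set_decode w))"
      unfolding ok_def
      by (intro semidecidable_in_ex semidecidable_in_decidable decidable_in_conj decidable_in_eq
          decidable_in_all_less decidable_in_iff decidable_in_imp decidable_in_set_decode
          decidable_in_oracle recursive_in_comp_pair[OF c] recursive_intros)
  qed
qed

text \<open>A finite greedy set rejects only finitely many elements of \<open>H\<close>; any further
  element would be accepted.\<close>

lemma infinite_greedy:
  assumes "infinite H" "\<And>x. x \<in> H \<Longrightarrow> finite {y \<in> H. \<not> c x y}"
  shows "infinite {y. greedy c H y}"
proof
  assume fin: "finite {y. greedy c H y}"
  have sub: "{y. greedy c H y} \<subseteq> H"
    by (auto dest: greedyD)
  let ?B = "(\<Union>x\<in>{y. greedy c H y}. {y \<in> H. \<not> c x y}) \<union> {y. greedy c H y}"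
  have "finite ?B"
    using fin assms(2) sub by auto
  then obtain y where "y \<in> H" "y \<notin> ?B"
    using assms(1) by (meson finite_subset subsetI)
  then have "greedy c H y"
    by (subst greedy.simps) auto
  with \<open>y \<notin> ?B\<close> show False
    by blast
qed

text \<open>Decidability of \<open>c\<close> is assumed for every oracle since it is used relative
  to each reservoir and to the set thinned out at the end.\<close>

theorem Seetapun:
  assumes c: "\<And>X. decidable_in X (\<lambda>e. c (pfst e) (psnd e))" and Y: "infinite Y" "\<not> D \<le>\<^sub>T Y"
  shows "\<exists>H\<subseteq>Y. infinite H \<and> \<not> D \<le>\<^sub>T H \<and> (\<exists>b. \<forall>x\<in>H. \<forall>y\<in>H. x < y \<longrightarrow> c x y = b)"
proof -
  \<comment> \<open>For fixed \<open>x\<close> the color splits \<open>X\<close> into two parts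
    recursive in \<open>X\<close>, one of which is infinite.\<close>
  have half: "\<exists>X'\<subseteq>X. infinite X' \<and> \<not> D \<le>\<^sub>T X' \<and> (\<exists>b. \<forall>y\<in>X'. c x y = b)"
    if X: "infinite X" "\<not> D \<le>\<^sub>T X" for X x
  proof -
    have "X \<subseteq> {y \<in> X. c x y = True} \<union> {y \<in> X. c x y = False}" by blast
    then have "\<not> (finite {y \<in> X. c x y = True} \<and> finite {y \<in> X. c x y = False})"
      using X(1) finite_subset by blast
    then obtain b where "infinite {y \<in> X. c x y = b}"
      by blast
    moreover have "decidable_in X (\<lambda>y. y \<in> X \<and> (c x y \<longleftrightarrow> b))"
      by (intro decidable_in_conj decidable_in_oracle decidable_in_iff decidable_in_const
          recursive_in_comp_pair[OF c] recursive_intros)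
    then have "{y \<in> X. c x y = b} \<le>\<^sub>T X"
      by (simp add: turing_reducible_iff)
    then have "\<not> D \<le>\<^sub>T {y \<in> X. c x y = b}"
      using X(2) turing_reducible_trans by blast
    ultimately show ?thesis
      by (intro exI[of _ "{y \<in> X. c x y = b}"]) blast
  qed
  have "\<exists>S\<subseteq>Y. infinite S \<and> \<not> D \<le>\<^sub>T S \<and>
      (\<forall>x. \<exists>E. finite E \<and> (\<exists>b. \<forall>y\<in>S - E. c x y = b))"
    by (rule ex_generic_set[OF Y, where R = "\<lambda>x X. \<exists>b. \<forall>y\<in>X. c x y = b", OF _ half]) blast
  then obtain S where S: "S \<subseteq> Y" "infinite S" "\<not> D \<le>\<^sub>T S"
    "\<And>x. \<exists>E. finite E \<and> (\<exists>b. \<forall>y\<in>S - E. c x y = b)"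
    by blast
  then obtain E lim where lim: "\<And>x. finite (E x)" "\<And>x y. y \<in> S - E x \<Longrightarrow> c x y = lim x"
    by metis
  \<comment> \<open>Nothing is known about the complexity of \<open>lim\<close>, hence the appeal to
    cone avoidance for arbitrary sets.\<close>
  obtain H where H: "H \<subseteq> S" "infinite H" "\<not> D \<le>\<^sub>T H" "H \<subseteq> {x. lim x} \<or> H \<inter> {x. lim x} = {}"
    using strong_cone_avoidance[OF S(2,3)] by blast
  then obtain b where b: "\<And>x. x \<in> H \<Longrightarrow> lim x = b" by blast
  let ?c = "\<lambda>x y. c x y \<longleftrightarrow> b"
  have "decidable_in H (\<lambda>e. ?c (pfst e) (psnd e))"
    by (intro decidable_in_iff decidable_in_const c)
  from turing_reducible_greedy[OF this] have "{y. greedy ?c H y} \<le>\<^sub>T H" .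
  then have "\<not> D \<le>\<^sub>T {y. greedy ?c H y}"
    using H(3) turing_reducible_trans by blast
  \<comment> \<open>Elements of \<open>H\<close> have limit color \<open>b\<close>, so the
    exceptions lie in \<open>E x\<close>.\<close>
  moreover have "finite {y \<in> H. \<not> ?c x y}" if "x \<in> H" for x
    by (rule finite_subset[OF _ lim(1)[of x]]) (use lim(2) b[OF that] H(1) in auto)
  then have "infinite {y. greedy ?c H y}"
    by (rule infinite_greedy[OF H(2)])
  moreover have "{y. greedy ?c H y} \<subseteq> Y"
    using H(1) S(1) by (auto dest: greedyD)
  moreover have "\<forall>x\<in>{y. greedy ?c H y}. \<forall>y\<in>{y. greedy ?c H y}. x < y \<longrightarrow> c x y = b"
    using greedyD(2)[of ?c H] by blast
  ultimately show ?thesis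
    by blast
qed

section \<open>Computable colorings and the construction of the cohesive set\<close>

text \<open>\<open>Zero\<close> answers all queries to the empty set correctly, so it can be
  substituted for \<open>Query\<close>.\<close>

lemma recursive_in_if_recursive_in_empty:
  assumes "recursive_in {} f" shows "recursive_in X f"
proof -
  obtain p where p: "\<And>n. computes {} p [n] (f n)"
    using assms unfolding recursive_in_def by blast
  have "computes X (subst_query Zero p) [n] (f n)" for n
    using p by (rule computes_subst_query) (simp add: computes.zero)
  then show ?thesis
    unfolding recursive_in_def by blast
qed

text \<open>
  A program for a coloring may diverge unless its arguments are increasing; replacing the second
  argument \<open>y\<close> by \<open>max (Suc x) y = y + (Suc x - y)\<close> makes it total.
\<close>

lemma decidable_in_coloring:
  assumes "\<And>x y. x < y \<Longrightarrow> computes {} p [x, y] (C {x, y})"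
  shows "decidable_in X (\<lambda>e. C {pfst e, psnd e + (Suc (pfst e) - psnd e)} = 1)"
proof -
  obtain q where q: "\<And>x y. computes {} q [x, y] (y + (Suc x - y))"
  proof -
    have "recursive2_in {} (\<lambda>x y. y + (Suc x - y))"
      by (intro recursive2_in_comp2[OF recursive2_in_add] recursive2_in_comp2[OF recursive2_in_diff]
          recursive2_in_comp1[OF recursive_in_Suc[OF recursive_in_id]]
          recursive2_in_fst recursive2_in_snd)
    then show ?thesis
      using that unfolding recursive2_in_def by blast
  qed
  have "computes {} (Comp p [Proj 0, q]) [x, y] (C {x, y + (Suc x - y)})" for x y
    by (rule computes_Comp2[OF _ q assms]) (auto intro: computes_Proj)
  then have "recursive2_in {} (\<lambda>x y. C {x, y + (Suc x - y)})"
    unfolding recursive2_in_def by blast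
  from recursive_in_if_recursive_in_empty[OF recursive2_in_comp[OF this recursive_in_pfst
      recursive_in_psnd, OF recursive_in_id recursive_in_id]]
  show ?thesis
    by (intro decidable_in_eq recursive_in_const)
qed

theorem theorem3p14:
  fixes D :: "nat set"
  assumes "\<not> computable_set D"
  shows "\<exists>A. two_r_cohesive A \<and> \<not> D \<le>\<^sub>T A"
proof -
  \<comment> \<open>\<open>R i\<close> is homogeneity for the coloring computed by program number
    \<open>i\<close>, and vacuous if there is none.\<close>
  define R where "R i A \<longleftrightarrow> (\<forall>C. two_coloring C \<longrightarrow>
    (\<forall>x y. x < y \<longrightarrow> computes {} (from_nat i) [x, y] (C {x, y})) \<longrightarrow>
    (\<exists>b. \<forall>x\<in>A. \<forall>y\<in>A. x < y \<longrightarrow> C {x, y} = b))" for i :: nat and A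
  have dense: "\<exists>X'\<subseteq>X. infinite X' \<and> \<not> D \<le>\<^sub>T X' \<and> R i X'"
    if X: "infinite X" "\<not> D \<le>\<^sub>T X" for i X
  proof (cases "\<exists>C. two_coloring C \<and>
      (\<forall>x y. x < y \<longrightarrow> computes {} (from_nat i) [x, y] (C {x, y}))")
    case False
    then show ?thesis
      using X unfolding R_def by blast
  next
    case True
    then obtain C where C: "two_coloring C"
      "\<And>x y. x < y \<Longrightarrow> computes {} (from_nat i) [x, y] (C {x, y})"
      by blast
    have "\<exists>H\<subseteq>X. infinite H \<and> \<not> D \<le>\<^sub>T H \<and>
        (\<exists>b. \<forall>x\<in>H. \<forall>y\<in>H. x < y \<longrightarrow> (C {x, y + (Suc x - y)} = 1) = b)"
      by (rule Seetapun[where c = "\<lambda>x y. C {x, y + (Suc x - y)} = 1",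
            OF decidable_in_coloring[OF C(2)] X])
    then obtain H b where H: "H \<subseteq> X" "infinite H" "\<not> D \<le>\<^sub>T H"
      and b: "\<And>x y. x \<in> H \<Longrightarrow> y \<in> H \<Longrightarrow> x < y \<Longrightarrow> (C {x, y + (Suc x - y)} = 1) = b"
      by metis
    have "R i H"
      unfolding R_def
    proof (intro allI impI exI ballI)
      fix C' x y
      assume C': "\<forall>x y. x < y \<longrightarrow> computes {} (from_nat i) [x, y] (C' {x, y})"
        and xy: "x \<in> H" "y \<in> H" "x < y"
      \<comment> \<open>Only the truth value of \<open>C {x, y} = 1\<close> is controlled; it
        determines the color because the values are 0 and 1.\<close>
      have "{x, y} \<in> [UNIV]\<^bsup>2\<^esup>"
        using xy(3) by (simp add: nsets_def)
      then have "C {x, y} \<in> {0, 1}"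
        using C(1) unfolding two_coloring_def by blast
      moreover have "(C {x, y} = 1) = b"
        using b[OF xy] xy(3) by simp
      moreover have "C' {x, y} = C {x, y}"
        using C' C(2) xy(3) computes_deterministic by blast
      ultimately show "C' {x, y} = of_bool b" by auto
    qed
    with H show ?thesis by blast
  qed
  have hereditary: "R i X \<Longrightarrow> X' \<subseteq> X \<Longrightarrow> R i X'" for i X X'
    unfolding R_def by (meson subsetD)
  \<comment> \<open>\<open>UNIV\<close> can serve as the initial reservoir: being recursive, it
    would make \<open>D\<close> computable if it computed \<open>D\<close>.\<close>
  have "decidable_in {} (\<lambda>n. n \<in> UNIV)"
    using decidable_in_const[of "{}" True] by simp
  then have "UNIV \<le>\<^sub>T {}"
    unfolding turing_reducible_iff .
  then have "\<not> D \<le>\<^sub>T UNIV"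
    using assms turing_reducible_trans unfolding computable_set_def by blast
  with infinite_UNIV_nat
  have "\<exists>H\<subseteq>UNIV. infinite H \<and> \<not> D \<le>\<^sub>T H \<and> (\<forall>i. \<exists>E. finite E \<and> R i (H - E))"
    by (rule ex_generic_set[where R = R, OF _ _ hereditary dense])
  then obtain H where H: "infinite H" "\<not> D \<le>\<^sub>T H" "\<And>i. \<exists>E. finite E \<and> R i (H - E)"
    by blast
  have "almost_homogeneous C H" if C: "two_coloring C" "computable_coloring C" for C
  proof -
    obtain p where p: "\<forall>x y. x < y \<longrightarrow> computes {} p [x, y] (C {x, y})"
      using C(2) unfolding computable_coloring_def by blast
    obtain E where E: "finite E" "R (to_nat p) (H - E)"
      using H(3) by blast
    have "\<exists>b. \<forall>x\<in>H - E. \<forall>y\<in>H - E. x < y \<longrightarrow> C {x, y} = b"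
      using E(2)[unfolded R_def from_nat_to_nat, THEN spec, THEN mp, THEN mp, OF C(1) p] .
    then obtain b where b: "\<And>x y. x \<in> H - E \<Longrightarrow> y \<in> H - E \<Longrightarrow> x < y \<Longrightarrow> C {x, y} = b"
      by metis
    have "C e = b" if "e \<in> [H - E]\<^bsup>2\<^esup>" for e
    proof -
      obtain x y where e: "e = {x, y}" "x \<noteq> y" "x \<in> H - E" "y \<in> H - E"
        using \<open>e \<in> [H - E]\<^bsup>2\<^esup>\<close> by (auto simp: nsets_def card_2_iff)
      then show ?thesis
        using b[of x y] b[of y x] by (cases x y rule: linorder_cases) (auto simp: insert_commute)
    qed
    then show ?thesis
      unfolding almost_homogeneous_def by (intro exI[of _ E] exI[of _ b] conjI ballI E(1))
  qed
  with H(1,2) show ?thesis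
    unfolding two_r_cohesive_def by blast
qed

end
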